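(* Let $m\ge2$, let $H$ be a complex Hilbert space, let $E$ be a POVM on $\Omega_m=\{0,\dots,m-1\}^{\mathbb N}$ with values in $B(H)$, and let $X=\{X_w\}$ be a bounded self-adjoint range martingale for $E$. Then $$Q_{n+1}(X)-Q_n(X)=\sum_{|w|=n}E_w^{1/2}\Gamma_w(X)E_w^{1/2}$$ for every $n\ge0$. In particular, $\{Q_n(X)\}_{n\ge0}$ is an increasing sequence of positive operators. If $M=\sup_w\|X_w\|$, then $$0\le Q_n(X)\le M^2I$$ for every $n$. Hence $Q_n(X)$ has a strong limit.
   Context: $\Omega_m$ carries its product Borel $\sigma$-algebra $\mathcal B(\Omega_m)$. For a finite word $w=w_1\cdots w_n$ in $\{0,\dots,m-1\}$, $|w|=n$ and $[w]=\{x\in\Omega_m:x_1=w_1,\dots,x_n=w_n\}$; the empty word is $\varnothing$, and $[\varnothing]=\Omega_m$; $wj$ is $w$ with the letter $j$ appended. A POVM on $\Omega_m$ with values in $B(H)$ is a map $E:\mathcal B(\Omega_m)\to B(H)_+$ that is countably additive in the weak operator topology and satisfies $E(\Omega_m)=I$. Put $E_w=E([w])$ and $H_w=\overline{\operatorname{ran}}(E_w^{1/2})$; operators on $H_w$ are extended by zero on $H_w^\perp$ when written inside $B(H)$. For $0\le j\le m-1$, the edge contraction $C_{wj}:H_w\to H_{wj}$ is the unique contraction with $C_{wj}E_w^{1/2}h=E_{wj}^{1/2}h$ for all $h\in H$. A bounded (self-adjoint) range martingale for $E$ is a family of self-adjoint operators $X_w\in B(H_w)$, indexed by all finite words $w$,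 such that $\sup_w\|X_w\|<\infty$ and $X_w=\sum_{j=0}^{m-1}C_{wj}^*X_{wj}C_{wj}$ for every $w$. The local variance of $X$ at $w$ is $\Gamma_w(X)=\sum_{j=0}^{m-1}C_{wj}^*X_{wj}^2C_{wj}-X_w^2\in B(H_w)$. Let $K_n=\bigoplus_{|w|=n}H_w$ (so $K_0=H$), let $J_n:K_n\to K_{n+1}$ be the isometry $(J_nx)_{wj}=C_{wj}x_w$, and $J_{0,n}=J_{n-1}\cdots J_0:H\to K_n$ ($J_{0,0}=I$). The level-$n$ square operator on $H$ is $Q_n(X)=J_{0,n}^*\big(\bigoplus_{|w|=n}X_w\big)^2J_{0,n}$; equivalently, $Q_n(X)=\sum_{|w|=n}E_w^{1/2}X_w^2E_w^{1/2}$. *)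

theory Defs
  imports "HOL-Analysis.Analysis"
begin

section \<open>Complex Hilbert spaces\<close>

text \<open>
  The norm, metric and topology come from \<^class>\<open>real_inner\<close>, whose real inner product is
  required to be the real part of the complex one. The complex inner product is linear in
  the first argument.
\<close>

class complex_inner = real_inner +
  fixes scaleC :: "complex \<Rightarrow> 'a \<Rightarrow> 'a"  (infixr \<open>*\<^sub>C\<close> 75)
    and cinner :: "'a \<Rightarrow> 'a \<Rightarrow> complex"
  assumes scaleC_add_right: "a *\<^sub>C (x + y) = a *\<^sub>C x + a *\<^sub>C y"
    and scaleC_add_left: "(a + b) *\<^sub>C x = a *\<^sub>C x + b *\<^sub>C x"
    and scaleC_scaleC: "a *\<^sub>C b *\<^sub>C x = (a * b) *\<^sub>C x"
    and scaleC_one: "1 *\<^sub>C x = x"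
    and scaleC_of_real: "complex_of_real r *\<^sub>C x = r *\<^sub>R x"
    and cinner_commute: "cinner x y = cnj (cinner y x)"
    and cinner_add_left: "cinner (x + y) z = cinner x z + cinner y z"
    and cinner_scaleC_left: "cinner (a *\<^sub>C x) y = a * cinner x y"
    and inner_eq_Re_cinner: "inner x y = Re (cinner x y)"

class complex_hilbert = complex_inner + complete_space

instantiation complex :: complex_hilbert
begin

definition scaleC_complex :: "complex \<Rightarrow> complex \<Rightarrow> complex" where
  "scaleC_complex a x = a * x"

definition cinner_complex :: "complex \<Rightarrow> complex \<Rightarrow> complex" where
  "cinner_complex x y = x * cnj y"

instance
  by standard
    (simp_all add: scaleC_complex_def cinner_complex_def algebra_simps inner_complex_def
       scaleR_conv_of_real)

end

section \<open>Bounded operators\<close>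

definition bounded_clinear :: "('a::complex_inner \<Rightarrow> 'b::complex_inner) \<Rightarrow> bool" where
  "bounded_clinear T \<longleftrightarrow> bounded_linear T \<and> (\<forall>c x. T (c *\<^sub>C x) = c *\<^sub>C T x)"

text \<open>
  The Hilbert adjoint of a map from \<open>'a\<close> into a space with inner product \<open>ip\<close>. The target
  inner product is a parameter because the direct sums \<open>K_n\<close> below are not types.
\<close>

definition cadjoint_wrt ::
    "('b \<Rightarrow> 'b \<Rightarrow> complex) \<Rightarrow> ('a::complex_hilbert \<Rightarrow> 'b) \<Rightarrow> 'b \<Rightarrow> 'a" where
  "cadjoint_wrt ip T y = (THE x. \<forall>v. cinner v x = ip (T v) y)"

definition cadjoint :: "('a::complex_hilbert \<Rightarrow> 'b::complex_hilbert) \<Rightarrow> 'b \<Rightarrow> 'a" where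
  "cadjoint = cadjoint_wrt cinner"

definition positive_op :: "('a::complex_hilbert \<Rightarrow> 'a) \<Rightarrow> bool" where
  "positive_op T \<longleftrightarrow> bounded_clinear T \<and> (\<forall>x. cinner (T x) x \<in> \<real>\<^sub>\<ge>\<^sub>0)"

definition op_le :: "('a::complex_hilbert \<Rightarrow> 'a) \<Rightarrow> ('a \<Rightarrow> 'a) \<Rightarrow> bool" where
  "op_le S T \<longleftrightarrow> positive_op (\<lambda>x. T x - S x)"

definition op_sqrt :: "('a::complex_hilbert \<Rightarrow> 'a) \<Rightarrow> 'a \<Rightarrow> 'a" where
  "op_sqrt T = (THE S. positive_op S \<and> S \<circ> S = T)"

definition ocompl :: "'a::complex_hilbert set \<Rightarrow> 'a set" where
  "ocompl V = {x. \<forall>v\<in>V. cinner x v = 0}"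

text \<open>
  An element of \<open>B(V, W)\<close>, for closed subspaces \<open>V\<close> and \<open>W\<close>, is represented by its extension
  by zero on the orthogonal complement of \<open>V\<close>. Products, adjoints and norms of
  the extensions are the extensions (respectively the norms) of those on the subspaces.
\<close>

definition op_between ::
    "'a::complex_hilbert set \<Rightarrow> 'a set \<Rightarrow> ('a \<Rightarrow> 'a) \<Rightarrow> bool" where
  "op_between V W T \<longleftrightarrow>
     bounded_clinear T \<and> (\<forall>x. T x \<in> W) \<and> (\<forall>x\<in>ocompl V. T x = 0)"

section \<open>Words, cylinders and POVMs\<close>

text \<open>
  Sequences are indexed from 0. Since the alphabet is finite and discrete and there are
  countably many factors, the product \<open>\<sigma>\<close>-algebra is the Borel \<open>\<sigma>\<close>-algebra of the product
  topology.
\<close>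

definition Omega :: "nat \<Rightarrow> (nat \<Rightarrow> nat) measure" where
  "Omega m = PiM UNIV (\<lambda>_. count_space {..<m})"

definition words :: "nat \<Rightarrow> nat list set" where
  "words m = {w. set w \<subseteq> {..<m}}"

definition words_len :: "nat \<Rightarrow> nat \<Rightarrow> nat list set" where
  "words_len m n = {w \<in> words m. length w = n}"

definition cylinder :: "nat \<Rightarrow> nat list \<Rightarrow> (nat \<Rightarrow> nat) set" where
  "cylinder m w = {x \<in> space (Omega m). \<forall>i<length w. x i = w ! i}"

definition povm :: "nat \<Rightarrow> ((nat \<Rightarrow> nat) set \<Rightarrow> 'a::complex_hilbert \<Rightarrow> 'a) \<Rightarrow> bool" where
  "povm m E \<longleftrightarrow>
     (\<forall>A\<in>sets (Omega m). positive_op (E A)) \<and>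
     (\<forall>A :: nat \<Rightarrow> (nat \<Rightarrow> nat) set.
        range A \<subseteq> sets (Omega m) \<longrightarrow> disjoint_family A \<longrightarrow>
        (\<forall>x y. (\<lambda>k. cinner (E (A k) x) y) sums cinner (E (\<Union>k. A k) x) y)) \<and>
     E (space (Omega m)) = id"

definition E_root ::
    "nat \<Rightarrow> ((nat \<Rightarrow> nat) set \<Rightarrow> 'a::complex_hilbert \<Rightarrow> 'a) \<Rightarrow> nat list \<Rightarrow> 'a \<Rightarrow> 'a" where
  "E_root m E w = op_sqrt (E (cylinder m w))"

definition H_space ::
    "nat \<Rightarrow> ((nat \<Rightarrow> nat) set \<Rightarrow> 'a::complex_hilbert \<Rightarrow> 'a) \<Rightarrow> nat list \<Rightarrow> 'a set" where
  "H_space m E w = closure (range (E_root m E w))"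

definition edge_contraction ::
    "nat \<Rightarrow> ((nat \<Rightarrow> nat) set \<Rightarrow> 'a::complex_hilbert \<Rightarrow> 'a) \<Rightarrow> nat list \<Rightarrow> nat \<Rightarrow> 'a \<Rightarrow> 'a" where
  "edge_contraction m E w j =
     (THE C. op_between (H_space m E w) (H_space m E (w @ [j])) C \<and>
             (\<forall>x. norm (C x) \<le> norm x) \<and>
             (\<forall>h. C (E_root m E w h) = E_root m E (w @ [j]) h))"

section \<open>Range martingales and their square operators\<close>

definition bounded_sa_range_martingale ::
    "nat \<Rightarrow> ((nat \<Rightarrow> nat) set \<Rightarrow> 'a::complex_hilbert \<Rightarrow> 'a) \<Rightarrow> (nat list \<Rightarrow> 'a \<Rightarrow> 'a) \<Rightarrow> bool"
  where
  "bounded_sa_range_martingale m E X \<longleftrightarrow>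
     (\<forall>w\<in>words m. op_between (H_space m E w) (H_space m E w) (X w) \<and> cadjoint (X w) = X w) \<and>
     bdd_above ((\<lambda>w. onorm (X w)) ` words m) \<and>
     (\<forall>w\<in>words m. \<forall>x. X w x =
        (\<Sum>j<m. cadjoint (edge_contraction m E w j)
                  (X (w @ [j]) (edge_contraction m E w j x))))"

definition local_variance ::
    "nat \<Rightarrow> ((nat \<Rightarrow> nat) set \<Rightarrow> 'a::complex_hilbert \<Rightarrow> 'a) \<Rightarrow> (nat list \<Rightarrow> 'a \<Rightarrow> 'a) \<Rightarrow>
     nat list \<Rightarrow> 'a \<Rightarrow> 'a" where
  "local_variance m E X w x =
     (\<Sum>j<m. cadjoint (edge_contraction m E w j)
               (X (w @ [j]) (X (w @ [j]) (edge_contraction m E w j x))))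
     - X w (X w x)"

text \<open>
  The direct sum \<open>K_n\<close> consists of the families \<open>x\<close> with \<open>x w\<close> in \<open>H_w\<close> for the words \<open>w\<close> of
  length \<open>n\<close>, and \<open>x w = 0\<close> for every other list \<open>w\<close>; its inner product is
  \<open>K_inner m n\<close>. The three maps below send such families to such families.
\<close>

definition K_inner ::
    "nat \<Rightarrow> nat \<Rightarrow> (nat list \<Rightarrow> 'a::complex_hilbert) \<Rightarrow> (nat list \<Rightarrow> 'a) \<Rightarrow> complex" where
  "K_inner m n x y = (\<Sum>w\<in>words_len m n. cinner (x w) (y w))"

definition J_step ::
    "nat \<Rightarrow> ((nat \<Rightarrow> nat) set \<Rightarrow> 'a::complex_hilbert \<Rightarrow> 'a) \<Rightarrow> nat \<Rightarrow>
     (nat list \<Rightarrow> 'a) \<Rightarrow> nat list \<Rightarrow> 'a" where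
  "J_step m E n x v =
     (if v \<in> words_len m (Suc n)
      then edge_contraction m E (butlast v) (last v) (x (butlast v)) else 0)"

primrec J_iter ::
    "nat \<Rightarrow> ((nat \<Rightarrow> nat) set \<Rightarrow> 'a::complex_hilbert \<Rightarrow> 'a) \<Rightarrow> nat \<Rightarrow>
     'a \<Rightarrow> nat list \<Rightarrow> 'a" where
  "J_iter m E 0 = (\<lambda>h w. if w = [] then h else 0)"
| "J_iter m E (Suc n) = J_step m E n \<circ> J_iter m E n"

definition diag_op ::
    "nat \<Rightarrow> (nat list \<Rightarrow> 'a::complex_hilbert \<Rightarrow> 'a) \<Rightarrow> nat \<Rightarrow>
     (nat list \<Rightarrow> 'a) \<Rightarrow> nat list \<Rightarrow> 'a" where
  "diag_op m X n x w = (if w \<in> words_len m n then X w (x w) else 0)"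

definition square_op ::
    "nat \<Rightarrow> ((nat \<Rightarrow> nat) set \<Rightarrow> 'a::complex_hilbert \<Rightarrow> 'a) \<Rightarrow> (nat list \<Rightarrow> 'a \<Rightarrow> 'a) \<Rightarrow>
     nat \<Rightarrow> 'a \<Rightarrow> 'a" where
  "square_op m E X n =
     cadjoint_wrt (K_inner m n) (J_iter m E n) \<circ> diag_op m X n \<circ> diag_op m X n \<circ> J_iter m E n"

end

theory Submission
  imports Defs
begin

text \<open>
  Write \<open>R_w\<close> for the root of \<open>E_w\<close> and \<open>C_wj\<close> for the edge contractions, so that
  \<open>C_wj R_w = R_wj\<close>. By induction the component of \<open>J_{0,n} h\<close> at a word \<open>w\<close> of length \<open>n\<close> is
  \<open>R_w h\<close> (\<open>J_iter_eq\<close>), so the square operator is the sum of \<open>R_w X_w\<^sup>2 R_w\<close> over these words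
  (\<open>square_op_eq\<close>). Taking adjoints in \<open>C_wj R_w = R_wj\<close> gives \<open>R_w C_wj\<^sup>* = R_wj\<close>, and the
  increment formula is a regrouping of the next level by parent words (\<open>square_op_Suc_diff\<close>).

  Monotonicity is nonnegativity of the local variance (\<open>norm_martingale_le\<close>): additivity of the
  measure makes the \<open>C_wj\<close> jointly isometric on \<open>H_w\<close>, so with the martingale equation the form of
  the local variance at \<open>x\<close> is the sum over \<open>j\<close> of \<open>(norm (X_wj C_wj x - C_wj X_w x))\<^sup>2\<close>. The upper
  bound holds because the squares \<open>(norm (R_w h))\<^sup>2\<close> over a level add up to \<open>(norm h)\<^sup>2\<close>, and the
  strong limit is Vigier's theorem (\<open>increasing_positive_op_limit\<close>).

  The roots, the edge contractions and the adjoints are given by definite descriptions, so their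
  existence and uniqueness must be established. Adjoints, orthogonal decompositions and the
  factorization \<open>range_contraction_exists\<close> behind the edge contractions all come from one Riesz
  theorem relative to the closure of the range of an operator (\<open>riesz_closure_range\<close>). Square
  roots (\<open>op_sqrt\<close>) come from a monotone iteration and the limit theorem.
\<close>

section \<open>Complex and real inner products\<close>

lemma inner_scaleC_left: "inner (a *\<^sub>C x) y = inner x (cnj a *\<^sub>C (y::'a::complex_inner))"
proof -
  have "cinner x (cnj a *\<^sub>C y) = a * cinner x y"
    by (metis cinner_commute cinner_scaleC_left complex_cnj_cnj complex_cnj_mult)
  then show ?thesis
    by (simp add: inner_eq_Re_cinner cinner_scaleC_left)
qed

lemma cinner_eq_Complex:
  "cinner x y = Complex (inner x y) (inner x (\<i> *\<^sub>C (y::'a::complex_inner)))"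
proof (rule complex_eqI)
  have "inner x (\<i> *\<^sub>C y) = inner ((-\<i>) *\<^sub>C x) y"
    by (simp add: inner_scaleC_left)
  then show "Im (cinner x y) = Im (Complex (inner x y) (inner x (\<i> *\<^sub>C y)))"
    by (simp add: inner_eq_Re_cinner cinner_scaleC_left)
qed (simp add: inner_eq_Re_cinner)

lemma scaleC_diff_right: "a *\<^sub>C (x - y) = a *\<^sub>C x - a *\<^sub>C (y::'a::complex_inner)"
  using scaleC_add_right[of a "x - y" y] by simp

lemma scaleC_zero_right: "a *\<^sub>C 0 = (0::'a::complex_inner)"
  using scaleC_diff_right[of a 0 0] by simp

lemma scaleC_scaleR: "a *\<^sub>C (r *\<^sub>R x) = r *\<^sub>R (a *\<^sub>C (x::'a::complex_inner))"
  by (simp add: scaleC_scaleC mult.commute flip: scaleC_of_real)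

lemma bounded_linear_scaleC: "bounded_linear ((*\<^sub>C) a :: 'a::complex_inner \<Rightarrow> 'a)"
proof (rule bounded_linear_intro[where K = "cmod a"])
  fix x :: 'a
  have "inner (a *\<^sub>C x) (a *\<^sub>C x) = inner x (((cmod a)\<^sup>2) *\<^sub>R x)"
    unfolding inner_scaleC_left[of a x] scaleC_scaleC
    by (metis complex_norm_square mult.commute scaleC_of_real)
  then have "(norm (a *\<^sub>C x))\<^sup>2 = (norm x * cmod a)\<^sup>2"
    by (simp add: dot_square_norm power_mult_distrib)
  then show "norm (a *\<^sub>C x) \<le> norm x * cmod a"
    by (metis norm_ge_zero mult_nonneg_nonneg order_refl power2_eq_iff_nonneg)
qed (simp_all add: scaleC_add_right scaleC_scaleR)

section \<open>Bounded complex-linear maps\<close>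

lemma bounded_clinearI:
  assumes "\<And>x y. T (x + y) = T x + T y" "\<And>c x. T (c *\<^sub>C x) = c *\<^sub>C T x"
    and "\<And>x. norm (T x) \<le> norm x * K"
  shows "bounded_clinear T"
proof -
  have "T (r *\<^sub>R x) = r *\<^sub>R T x" for r x
    using assms(2)[of "complex_of_real r" x] by (simp add: scaleC_of_real)
  then show ?thesis
    unfolding bounded_clinear_def using assms bounded_linear_intro[of T K] by blast
qed

lemma bounded_clinearD:
  assumes "bounded_clinear T"
  shows "bounded_linear T" "linear T" "T (c *\<^sub>C x) = c *\<^sub>C T x"
  using assms by (auto simp: bounded_clinear_def bounded_linear.linear)

lemma bounded_clinear_simps:
  assumes "bounded_clinear T"
  shows "T (x + y) = T x + T y" "T (x - y) = T x - T y" "T 0 = 0" "T (r *\<^sub>R x) = r *\<^sub>R T x"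
    "T (sum f I) = (\<Sum>i\<in>I. T (f i))"
  using bounded_clinearD(2)[OF assms]
  by (simp_all add: linear_add linear_diff linear_0 linear_cmul linear_sum)

lemma bounded_clinear_zero: "bounded_clinear (\<lambda>x. 0)"
  by (rule bounded_clinearI[where K = 0]) (simp_all add: scaleC_zero_right)

lemma bounded_clinear_ident: "bounded_clinear (\<lambda>x. x)"
  by (rule bounded_clinearI[where K = 1]) simp_all

lemma bounded_clinear_compose:
  "bounded_clinear S \<Longrightarrow> bounded_clinear T \<Longrightarrow> bounded_clinear (\<lambda>x. S (T x))"
  using bounded_linear_compose[of S T] by (simp add: bounded_clinear_def)

lemma bounded_clinear_add:
  "bounded_clinear S \<Longrightarrow> bounded_clinear T \<Longrightarrow> bounded_clinear (\<lambda>x. S x + T x)"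
  using bounded_linear_add[of S T] by (simp add: bounded_clinear_def scaleC_add_right)

lemma bounded_clinear_diff:
  "bounded_clinear S \<Longrightarrow> bounded_clinear T \<Longrightarrow> bounded_clinear (\<lambda>x. S x - T x)"
  using bounded_linear_sub[of S T] by (simp add: bounded_clinear_def scaleC_diff_right)

lemma bounded_clinear_scaleR:
  "bounded_clinear S \<Longrightarrow> bounded_clinear (\<lambda>x. r *\<^sub>R S x)"
  using bounded_linear_compose[OF bounded_linear_scaleR_right, of S r]
  by (simp add: bounded_clinear_def scaleC_scaleR)

text \<open>
  For complex-linear maps it suffices to verify an adjoint relation on real parts; this is why
  the real inner product carries most of the argument below.
\<close>

lemma cinner_eq_if_inner_eq:
  assumes "bounded_clinear T" and "\<And>v. inner v x = inner (T v) y"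
  shows "cinner v x = cinner (T v) y"
proof -
  have "inner v (\<i> *\<^sub>C x) = inner ((-\<i>) *\<^sub>C v) x"
    by (simp add: inner_scaleC_left)
  also have "\<dots> = inner (T v) (\<i> *\<^sub>C y)"
    by (simp add: assms(2) bounded_clinearD(3)[OF assms(1)] inner_scaleC_left)
  finally show ?thesis
    by (simp add: cinner_eq_Complex assms(2))
qed

lemma bounded_clinear_adjoint:
  assumes T: "bounded_clinear T" and F: "\<And>v y. inner v (F y) = inner (T v) y"
  shows "bounded_clinear F"
proof -
  obtain K where K: "K > 0" "\<And>x. norm (T x) \<le> norm x * K"
    using bounded_linear.pos_bounded[OF bounded_clinearD(1)[OF T]] by blast
  have eq: "x = y" if "\<And>v. inner v x = inner v y" for x y :: 'a
    using that vector_eq_ldot[of x y] by blast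
  show ?thesis
  proof (rule bounded_clinearI)
    show "F (x + y) = F x + F y" for x y
      by (rule eq) (simp add: F inner_add_right)
    show "F (c *\<^sub>C x) = c *\<^sub>C F x" for c x
    proof (rule eq)
      fix v
      have "inner v (c *\<^sub>C F x) = inner (cnj c *\<^sub>C v) (F x)"
        by (simp add: inner_scaleC_left)
      also have "\<dots> = inner v (F (c *\<^sub>C x))"
        by (simp add: F bounded_clinearD(3)[OF T] inner_scaleC_left)
      finally show "inner v (F (c *\<^sub>C x)) = inner v (c *\<^sub>C F x)" ..
    qed
    fix y
    have "norm (F y) * norm (F y) = inner (T (F y)) y"
      by (metis F dot_square_norm power2_eq_square)
    also have "\<dots> \<le> norm (F y) * K * norm y"
      by (meson K(2) mult_right_mono norm_cauchy_schwarz norm_ge_zero order_trans)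
    finally have "norm (F y) * norm (F y) \<le> norm (F y) * (norm y * K)"
      by (simp add: mult_ac)
    then show "norm (F y) \<le> norm y * K"
      using K(1) by (cases "norm (F y) = 0") (auto simp: mult_le_cancel_left_pos)
  qed
qed

section \<open>Riesz representation and adjoints\<close>

lemma linear_coefficient_zero:
  fixes a b :: real
  assumes "b \<ge> 0" and "\<And>t. 0 \<le> 2 * t * a + t\<^sup>2 * b"
  shows "a = 0"
proof (rule ccontr)
  assume "a \<noteq> 0"
  define t where "t = - a / (b + 1)"
  have t: "a = - t * (b + 1)" using assms(1) by (simp add: t_def field_simps)
  then have "t \<noteq> 0" using \<open>a \<noteq> 0\<close> by auto
  have "2 * t * a + t\<^sup>2 * b = - (t\<^sup>2 * (b + 2))"
    unfolding t by (simp add: power2_eq_square algebra_simps)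
  moreover have "t\<^sup>2 * (b + 2) > 0" using \<open>t \<noteq> 0\<close> assms(1) by simp
  ultimately show False using assms(2)[of t] by linarith
qed

text \<open>
  A Riesz theorem relative to the range of \<open>R\<close>: a functional dominated by \<open>norm (R h)\<close> is given
  by a vector in the closure of that range. The vector is the limit of \<open>R h\<close> along a minimizing
  sequence of \<open>(norm (R h))\<^sup>2 - 2 * f h\<close>; the parallelogram law makes it Cauchy. The choice
  \<open>R = id\<close> is the usual Riesz theorem, and \<open>f h = inner (R h) x\<close> yields the orthogonal
  projection of \<open>x\<close> onto the closure of the range.
\<close>

lemma riesz_closure_range:
  fixes R :: "'b::real_vector \<Rightarrow> 'a::{real_inner,complete_space}" and f :: "'b \<Rightarrow> real"
  assumes R: "linear R" and f: "linear f" and bound: "\<And>h. f h \<le> c * norm (R h)"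
  obtains z where "z \<in> closure (range R)" "\<And>h. inner (R h) z = f h"
proof -
  define g where "g h = (norm (R h))\<^sup>2 - 2 * f h" for h
  have lower: "- c\<^sup>2 \<le> g h" for h
  proof -
    have "0 \<le> (norm (R h) - c)\<^sup>2" by simp
    also have "\<dots> = (norm (R h))\<^sup>2 - 2 * (c * norm (R h)) + c\<^sup>2"
      by (simp add: power2_diff)
    finally show ?thesis using bound[of h] by (simp add: g_def)
  qed
  then have bdd: "bdd_below (range g)" by (meson bdd_belowI2)
  define d where "d = (INF h. g h)"
  have d: "d \<le> g h" for h unfolding d_def by (rule cINF_lower[OF bdd]) simp
  have "\<exists>h. g h < d + inverse (real (Suc n))" for n
    using cINF_less_iff[of UNIV g "d + inverse (real (Suc n))"] bdd
    by (simp add: d_def)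
  then obtain h where h: "g (h n) < d + inverse (real (Suc n))" for n by metis
  have g_lim: "(\<lambda>n. g (h n)) \<longlonglongrightarrow> d"
  proof (rule tendsto_sandwich)
    show "(\<lambda>n. d) \<longlonglongrightarrow> d" by simp
    have "(\<lambda>n. d + inverse (real (Suc n))) \<longlonglongrightarrow> d + 0"
      by (intro tendsto_intros LIMSEQ_inverse_real_of_nat)
    then show "(\<lambda>n. d + inverse (real (Suc n))) \<longlonglongrightarrow> d" by simp
  qed (use h d in \<open>auto intro!: always_eventually less_imp_le simp del: of_nat_Suc\<close>)
  have par: "(norm (R x - R y))\<^sup>2 \<le> 2 * (g x - d) + 2 * (g y - d)" for x y
  proof -
    define u where "u = (1/2) *\<^sub>R (x + y)"
    have Ru: "R u = (1/2) *\<^sub>R (R x + R y)"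
      unfolding u_def linear_cmul[OF R] linear_add[OF R] ..
    have fu: "f u = (1/2) * (f x + f y)"
      unfolding u_def linear_cmul[OF f] linear_add[OF f] by simp
    have "(norm (R x - R y))\<^sup>2 = 2 * g x + 2 * g y - 4 * g u"
      unfolding g_def Ru fu power2_norm_eq_inner
      by (simp add: inner_add_left inner_add_right inner_diff_left inner_diff_right
          inner_commute[of "R y" "R x"] field_simps)
    then show ?thesis using d[of u] by simp
  qed
  have "Cauchy (\<lambda>n. R (h n))"
  proof (rule CauchyI)
    fix e :: real assume e: "e > 0"
    then have "eventually (\<lambda>n. g (h n) < d + (e * e) / 4) sequentially"
      by (intro order_tendstoD(2)[OF g_lim]) simp
    then obtain N where N: "\<And>n. n \<ge> N \<Longrightarrow> g (h n) < d + (e * e) / 4"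
      by (auto simp: eventually_sequentially)
    have "norm (R (h m) - R (h n)) < e" if "m \<ge> N" "n \<ge> N" for m n
    proof -
      have "(norm (R (h m) - R (h n)))\<^sup>2 < e\<^sup>2"
        using par[of "h m" "h n"] N[OF that(1)] N[OF that(2)]
        by (simp add: power2_eq_square)
      then show ?thesis using e by (simp add: power2_less_imp_less)
    qed
    then show "\<exists>M. \<forall>m\<ge>M. \<forall>n\<ge>M. norm (R (h m) - R (h n)) < e" by blast
  qed
  then have "convergent (\<lambda>n. R (h n))"
    by (rule Cauchy_convergent)
  then obtain z where z: "(\<lambda>n. R (h n)) \<longlonglongrightarrow> z"
    unfolding convergent_def ..
  have "z \<in> closure (range R)"
    unfolding closure_sequential using z by (intro exI[of _ "\<lambda>n. R (h n)"]) auto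
  moreover have "inner (R v) z = f v" for v
  proof -
    have "0 \<le> 2 * t * (inner z (R v) - f v) + t\<^sup>2 * (norm (R v))\<^sup>2" for t
    proof -
      have g_eq: "g (h n + t *\<^sub>R v) =
          g (h n) + (2 * t * (inner (R (h n)) (R v) - f v) + t\<^sup>2 * (norm (R v))\<^sup>2)" for n
        unfolding g_def power2_norm_eq_inner
        by (simp add: linear_add[OF R] linear_add[OF f] linear_cmul[OF R] linear_cmul[OF f]
            inner_add_left inner_add_right inner_commute[of "R v" "R (h n)"] algebra_simps
            power2_eq_square)
      have "(\<lambda>n. g (h n) + (2 * t * (inner (R (h n)) (R v) - f v) + t\<^sup>2 * (norm (R v))\<^sup>2)) \<longlonglongrightarrow>
          d + (2 * t * (inner z (R v) - f v) + t\<^sup>2 * (norm (R v))\<^sup>2)"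
        by (intro tendsto_intros g_lim z)
      then have "d \<le> d + (2 * t * (inner z (R v) - f v) + t\<^sup>2 * (norm (R v))\<^sup>2)"
        by (rule LIMSEQ_le_const) (use d g_eq in \<open>auto simp flip: g_eq\<close>)
      then show ?thesis by simp
    qed
    from linear_coefficient_zero[OF _ this] show ?thesis by (simp add: inner_commute)
  qed
  ultimately show ?thesis using that by blast
qed

lemma inner_zero_closure:
  assumes "x \<in> closure A" "\<And>a. a \<in> A \<Longrightarrow> inner a u = 0"
  shows "inner x u = 0"
proof -
  have "closure A \<subseteq> {x. inner x u = 0}"
    by (rule closure_minimal)
      (use assms(2) in \<open>auto intro!: closed_Collect_eq continuous_intros\<close>)
  then show ?thesis using assms(1) by auto
qed

lemma closure_range_eqI:
  assumes "x \<in> closure (range R)" "y \<in> closure (range R)" "\<And>h. inner (R h) x = inner (R h) y"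
  shows "x = y"
proof -
  have "inner z (x - y) = 0" if "z \<in> closure (range R)" for z
    using that by (rule inner_zero_closure) (auto simp: inner_diff_right assms(3))
  from this[OF assms(1)] this[OF assms(2)] have "inner (x - y) (x - y) = 0"
    by (simp only: inner_diff_left)
  then show ?thesis by simp
qed

lemma closure_range_decomp:
  fixes R :: "'b::real_vector \<Rightarrow> 'a::{real_inner,complete_space}"
  assumes "linear R"
  obtains z u where "x = z + u" "z \<in> closure (range R)" "\<And>h. inner (R h) u = 0"
proof -
  have "linear (\<lambda>h. inner (R h) x)"
    by (intro linearI) (simp_all add: linear_add[OF assms] linear_cmul[OF assms] inner_add_left)
  moreover have "inner (R h) x \<le> norm x * norm (R h)" for h
    using norm_cauchy_schwarz[of "R h" x] by (simp add: mult.commute)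
  ultimately obtain z where z: "z \<in> closure (range R)" "\<And>h. inner (R h) z = inner (R h) x"
    using riesz_closure_range[OF assms] by blast
  show ?thesis by (rule that[of z "x - z"]) (auto simp: z inner_diff_right)
qed

lemma cadjoint_inner:
  assumes T: "bounded_clinear T"
  shows "inner v (cadjoint T y) = inner (T v) y"
proof -
  obtain K where K: "\<And>x. norm (T x) \<le> norm x * K"
    using bounded_linear.bounded[OF bounded_clinearD(1)[OF T]] by metis
  have lin: "linear (\<lambda>h. inner (T h) y)"
    by (intro linearI) (simp_all add: bounded_clinear_simps[OF T] inner_add_left)
  have "inner (T h) y \<le> (K * norm y) * norm (id h)" for h
    using norm_cauchy_schwarz[of "T h" y] mult_right_mono[OF K[of h], of "norm y"]
    by (simp add: mult_ac)
  from riesz_closure_range[OF linear_id lin this]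
  obtain z where z: "\<And>h. inner h z = inner (T h) y" by auto
  have "cadjoint T y = z"
    unfolding cadjoint_def cadjoint_wrt_def
  proof (rule the_equality)
    show "\<forall>v. cinner v z = cinner (T v) y"
      using cinner_eq_if_inner_eq[OF T z] by blast
    show "x = z" if "\<forall>v. cinner v x = cinner (T v) y" for x
    proof -
      have "inner v x = inner v z" for v
        using that z[of v] by (simp add: inner_eq_Re_cinner)
      then show ?thesis using vector_eq_ldot[of x z] by blast
    qed
  qed
  then show ?thesis using z by simp
qed

section \<open>Positive operators and monotone limits\<close>

text \<open>
  On a complex space a positive form is automatically symmetric: the diagonal values being real
  at \<open>x + y\<close> and at \<open>x + \<i> y\<close> forces the off-diagonal ones to be conjugate.
\<close>

lemma positive_op_iff:
  "positive_op T \<longleftrightarrow>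
     bounded_clinear T \<and> (\<forall>x y. inner (T x) y = inner x (T y)) \<and> (\<forall>x. 0 \<le> inner (T x) x)"
proof (intro iffI conjI allI)
  assume T: "positive_op T"
  then show lin: "bounded_clinear T" by (simp add: positive_op_def)
  have real: "inner (T x) (\<i> *\<^sub>C x) = 0" for x
    using T by (simp add: positive_op_def cinner_eq_Complex complex_nonneg_Reals_iff)
  show "0 \<le> inner (T x) x" for x
    using T by (simp add: positive_op_def cinner_eq_Complex complex_nonneg_Reals_iff)
  have swap: "inner (T x) (\<i> *\<^sub>C y) = - inner (T y) (\<i> *\<^sub>C x)" for x y
    using real[of "x + y"] real[of x] real[of y]
    by (simp add: bounded_clinear_simps[OF lin] scaleC_add_right inner_add_left inner_add_right)
  have i2: "\<i> *\<^sub>C \<i> *\<^sub>C y = - y" for y :: 'a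
    using scaleC_of_real[of "-1" y] by (simp add: scaleC_scaleC)
  have i3: "inner (\<i> *\<^sub>C x) (\<i> *\<^sub>C y) = inner x y" for x y :: 'a
    using scaleC_of_real[of 1 y] by (simp add: inner_scaleC_left scaleC_scaleC)
  show "inner (T x) y = inner x (T y)" for x y
    using swap[of x "\<i> *\<^sub>C y"]
    by (simp add: i2 i3 bounded_clinearD(3)[OF lin] inner_commute)
next
  assume T: "bounded_clinear T \<and> (\<forall>x y. inner (T x) y = inner x (T y)) \<and> (\<forall>x. 0 \<le> inner (T x) x)"
  have "inner (T x) (\<i> *\<^sub>C x) = 0" for x
  proof -
    have "inner (T x) (\<i> *\<^sub>C x) = inner x (\<i> *\<^sub>C T x)"
      using T by (simp add: bounded_clinearD(3))
    also have "\<dots> = inner ((-\<i>) *\<^sub>C x) (T x)"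
      by (simp add: inner_scaleC_left)
    also have "\<dots> = - inner (T x) (\<i> *\<^sub>C x)"
      using scaleC_scaleC[of "-1" \<i> x] scaleC_of_real[of "-1" "\<i> *\<^sub>C x"]
      by (simp add: inner_commute)
    finally show ?thesis by simp
  qed
  with T show "positive_op T"
    by (auto simp: positive_op_def cinner_eq_Complex complex_nonneg_Reals_iff)
qed

lemma positive_opI:
  assumes "bounded_clinear T" "\<And>x y. inner (T x) y = inner x (T y)" "\<And>x. 0 \<le> inner (T x) x"
  shows "positive_op T"
  unfolding positive_op_iff using assms by blast

lemma positive_opD:
  assumes "positive_op T"
  shows "bounded_clinear T" "inner (T x) y = inner x (T y)" "0 \<le> inner (T x) x"
  using assms unfolding positive_op_iff by blast+

lemma positive_op_zero: "positive_op (\<lambda>x. 0)"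
  by (rule positive_opI) (simp_all add: bounded_clinear_zero)

lemma positive_op_ident: "positive_op (\<lambda>x. x)"
  by (rule positive_opI) (simp_all add: bounded_clinear_ident)

lemma positive_op_add:
  assumes "positive_op S" "positive_op T"
  shows "positive_op (\<lambda>x. S x + T x)"
  by (rule positive_opI)
    (use assms[THEN positive_opD(1)] assms[THEN positive_opD(2)] assms[THEN positive_opD(3)] in
      \<open>simp_all add: bounded_clinear_add inner_add_left inner_add_right\<close>)

lemma positive_op_scaleR:
  assumes "positive_op S" "0 \<le> r"
  shows "positive_op (\<lambda>x. r *\<^sub>R S x)"
proof (rule positive_opI)
  show "bounded_clinear (\<lambda>x. r *\<^sub>R S x)"
    by (intro bounded_clinear_scaleR positive_opD(1) assms(1))
  show "inner (r *\<^sub>R S x) y = inner x (r *\<^sub>R S y)" for x y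
    by (simp add: positive_opD(2)[OF assms(1)])
  show "0 \<le> inner (r *\<^sub>R S x) x" for x
    using positive_opD(3)[OF assms(1), of x] assms(2) by simp
qed

lemma positive_op_sum:
  assumes "\<And>i. i \<in> I \<Longrightarrow> positive_op (T i)"
  shows "positive_op (\<lambda>x. \<Sum>i\<in>I. T i x)"
  using assms
proof (induction I rule: infinite_finite_induct)
  case (insert i I)
  then show ?case using positive_op_add[of "T i" "\<lambda>x. \<Sum>i\<in>I. T i x"] by simp
qed (simp_all add: positive_op_zero)

lemma positive_op_conjugate:
  assumes A: "bounded_clinear A" "\<And>x y. inner (A x) y = inner x (A y)" and T: "positive_op T"
  shows "positive_op (\<lambda>x. A (T (A x)))"
proof (rule positive_opI)
  show "bounded_clinear (\<lambda>x. A (T (A x)))"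
    by (intro bounded_clinear_compose[OF A(1)] bounded_clinear_compose[OF positive_opD(1)[OF T]] A(1))
  show "inner (A (T (A x))) y = inner x (A (T (A y)))" for x y
    unfolding A(2) positive_opD(2)[OF T] ..
  show "0 \<le> inner (A (T (A x))) x" for x
    unfolding A(2)[of "T (A x)"] by (rule positive_opD(3)[OF T])
qed

lemma op_le_inner:
  "op_le S T \<Longrightarrow> inner (S x) x \<le> inner (T x) x"
  unfolding op_le_def using positive_opD(3)[of "\<lambda>x. T x - S x" x] by (simp add: inner_diff_left)

lemma op_leI:
  assumes S: "positive_op S" and T: "positive_op T" and "\<And>x. inner (S x) x \<le> inner (T x) x"
  shows "op_le S T"
  unfolding op_le_def
  by (rule positive_opI)
    (use positive_opD(2)[OF S] positive_opD(2)[OF T] assms(3) in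
      \<open>simp_all add: bounded_clinear_diff positive_opD(1)[OF S] positive_opD(1)[OF T]
        inner_diff_left inner_diff_right\<close>)

lemma positive_op_inner_bound:
  assumes "positive_op T"
  obtains c where "c > 0" "\<And>x. inner (T x) x \<le> c * (norm x)\<^sup>2"
proof -
  obtain K where K: "K > 0" "\<And>x. norm (T x) \<le> norm x * K"
    using bounded_linear.pos_bounded[OF bounded_clinearD(1)[OF positive_opD(1)[OF assms]]] by blast
  have "inner (T x) x \<le> K * (norm x)\<^sup>2" for x
    using norm_cauchy_schwarz[of "T x" x] mult_right_mono[OF K(2)[of x], of "norm x"]
    by (simp add: power2_eq_square mult_ac)
  then show ?thesis using that K(1) by blast
qed

text \<open>
  The form of \<open>T\<close> is nonnegative at \<open>x - (1/c) *\<^sub>R T x\<close>, and the inequality results upon expanding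
  and bounding the form at \<open>T x\<close> by \<open>c * (norm (T x))\<^sup>2\<close>.
\<close>

lemma positive_op_norm_le:
  assumes T: "positive_op T" and c: "c > 0" and bound: "\<And>x. inner (T x) x \<le> c * (norm x)\<^sup>2"
  shows "(norm (T x))\<^sup>2 \<le> c * inner (T x) x"
proof -
  note simps = bounded_clinear_simps[OF positive_opD(1)[OF T]]
  have "0 \<le> inner (T (x - (1/c) *\<^sub>R T x)) (x - (1/c) *\<^sub>R T x)"
    by (rule positive_opD(3)[OF T])
  also have "\<dots> = inner (T x) x - 2 / c * (norm (T x))\<^sup>2 + (1/c)\<^sup>2 * inner (T (T x)) (T x)"
    unfolding simps power2_norm_eq_inner inner_diff_left inner_diff_right inner_scaleR_left
      inner_scaleR_right
    by (simp add: positive_opD(2)[OF T] power2_eq_square algebra_simps)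
  also have "\<dots> \<le> inner (T x) x - 2 / c * (norm (T x))\<^sup>2 + (1/c)\<^sup>2 * (c * (norm (T x))\<^sup>2)"
    using bound[of "T x"] by (intro add_left_mono mult_left_mono) auto
  also have "\<dots> = inner (T x) x - (norm (T x))\<^sup>2 / c"
    using c by (simp add: power2_eq_square field_simps)
  finally show ?thesis
    using c by (simp add: field_simps)
qed

lemma positive_op_kernel:
  assumes T: "positive_op T" and "inner (T x) x = 0"
  shows "T x = 0"
proof -
  obtain c where "c > 0" "\<And>x. inner (T x) x \<le> c * (norm x)\<^sup>2"
    using positive_op_inner_bound[OF T] by blast
  from positive_op_norm_le[OF T this, of x] assms(2) show ?thesis by simp
qed

text \<open>
  Vigier's theorem. For \<open>k \<le> n\<close>, \<open>positive_op_norm_le\<close> bounds \<open>(norm (T n x - T k x))\<^sup>2\<close> by \<open>c\<close> times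
  the increment of the bounded increasing sequence \<open>inner (T n x) x\<close>, which is Cauchy.
\<close>

lemma increasing_positive_op_limit:
  assumes pos: "\<And>n. positive_op (T n)" and mono: "\<And>n. op_le (T n) (T (Suc n))"
    and c: "c > 0" and bound: "\<And>n x. inner (T n x) x \<le> c * (norm x)\<^sup>2"
  obtains Q where "positive_op Q" "\<And>x. (\<lambda>n. T n x) \<longlonglongrightarrow> Q x"
proof -
  define q where "q x n = inner (T n x) x" for x n
  have inc: "incseq (q x)" for x
    unfolding q_def by (rule incseq_SucI) (rule op_le_inner[OF mono])
  have "convergent (q x)" for x
  proof -
    have "\<forall>n. q x n \<le> c * (norm x)\<^sup>2"
      using bound by (simp add: q_def)
    from incseq_convergent[OF inc this] show ?thesis
      unfolding convergent_def by blast
  qed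
  have diff: "(norm (T n x - T k x))\<^sup>2 \<le> c * (q x n - q x k)" if "k \<le> n" for k n x
  proof -
    have "positive_op (\<lambda>x. T n x - T k x)"
      using op_leI[OF pos pos, of k n] incseqD[OF inc that] by (simp add: op_le_def q_def)
    moreover have "inner (T n x - T k x) x \<le> c * (norm x)\<^sup>2" for x
      using bound[of n x] positive_opD(3)[OF pos, of k x] by (simp add: inner_diff_left)
    ultimately show ?thesis
      using positive_op_norm_le[of "\<lambda>x. T n x - T k x" c x] c
      by (simp add: inner_diff_left q_def)
  qed
  have "Cauchy (\<lambda>n. T n x)" for x
  proof (rule CauchyI')
    fix e :: real assume e: "e > 0"
    then have "e\<^sup>2 / c > 0" using c by simp
    then obtain N where N: "\<And>m n. m \<ge> N \<Longrightarrow> n \<ge> N \<Longrightarrow> norm (q x m - q x n) < e\<^sup>2 / c"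
      using CauchyD[OF convergent_Cauchy[OF \<open>convergent (q x)\<close>]] by metis
    have "norm (T m x - T n x) < e" if "m \<ge> N" "n > m" for m n
    proof -
      have "c * (q x n - q x m) < c * (e\<^sup>2 / c)"
        using N[of n m] that c by (intro mult_strict_left_mono) auto
      then have "(norm (T n x - T m x))\<^sup>2 < e\<^sup>2"
        using diff[of m n x] that c by simp
      then show ?thesis using e by (simp add: power2_less_imp_less norm_minus_commute)
    qed
    then show "\<exists>M. \<forall>m\<ge>M. \<forall>n>m. dist (T m x) (T n x) < e"
      by (auto simp: dist_norm)
  qed
  then have "convergent (\<lambda>n. T n x)" for x
    by (rule Cauchy_convergent)
  then obtain Q where Q: "\<And>x. (\<lambda>n. T n x) \<longlonglongrightarrow> Q x"
    unfolding convergent_def by metis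
  have "bounded_clinear Q"
  proof (rule bounded_clinearI)
    show "Q (x + y) = Q x + Q y" for x y
      using LIMSEQ_unique[OF Q[of "x + y"]] tendsto_add[OF Q[of x] Q[of y]]
      by (simp add: bounded_clinear_simps[OF positive_opD(1)[OF pos]])
    show "Q (a *\<^sub>C x) = a *\<^sub>C Q x" for a x
      using LIMSEQ_unique[OF Q[of "a *\<^sub>C x"]] bounded_linear.tendsto[OF bounded_linear_scaleC Q[of x]]
      by (simp add: bounded_clinearD(3)[OF positive_opD(1)[OF pos]])
    have "norm (T n x) \<le> norm x * c" for n x
    proof -
      have "(norm (T n x))\<^sup>2 \<le> c * (c * (norm x)\<^sup>2)"
        using positive_op_norm_le[OF pos c bound, of n x] mult_left_mono[OF bound[of n x], of c] c
        by linarith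
      also have "\<dots> = (norm x * c)\<^sup>2" by (simp add: power2_eq_square)
      finally show ?thesis using c by (meson less_imp_le mult_nonneg_nonneg norm_ge_zero power2_le_imp_le)
    qed
    then show "norm (Q x) \<le> norm x * c" for x
      using LIMSEQ_le_const2[OF tendsto_norm[OF Q[of x]]] by blast
  qed
  moreover have "inner (Q x) y = inner x (Q y)" for x y
    using LIMSEQ_unique[OF tendsto_inner[OF Q[of x] tendsto_const[of y]]]
      tendsto_inner[OF tendsto_const[of x] Q[of y]]
    by (simp add: positive_opD(2)[OF pos])
  moreover have "0 \<le> inner (Q x) x" for x
    using LIMSEQ_le_const[OF tendsto_inner[OF Q[of x] tendsto_const[of x]]]
      positive_opD(3)[OF pos] by blast
  ultimately have "positive_op Q" by (simp add: positive_op_iff)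
  with Q show ?thesis using that by blast
qed

section \<open>Square roots of positive operators\<close>

text \<open>
  Polynomials in \<open>B\<close> with nonnegative real coefficients. For positive \<open>B\<close> they are positive, since
  all powers of \<open>B\<close> are.
\<close>

inductive nonneg_poly :: "('a::complex_hilbert \<Rightarrow> 'a) \<Rightarrow> ('a \<Rightarrow> 'a) \<Rightarrow> bool" for B where
  ident: "nonneg_poly B (\<lambda>x. x)"
| comp: "nonneg_poly B p \<Longrightarrow> nonneg_poly B (\<lambda>x. B (p x))"
| add: "nonneg_poly B p \<Longrightarrow> nonneg_poly B q \<Longrightarrow> nonneg_poly B (\<lambda>x. p x + q x)"
| scale: "nonneg_poly B p \<Longrightarrow> 0 \<le> r \<Longrightarrow> nonneg_poly B (\<lambda>x. r *\<^sub>R p x)"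

lemma positive_op_funpow:
  assumes B: "positive_op B"
  shows "positive_op (B ^^ k)"
proof (induction k rule: less_induct)
  case (less k)
  consider "k = 0" | "k = Suc 0" | j where "k = Suc (Suc j)"
    by (metis not0_implies_Suc)
  then show ?case
  proof cases
    case 3
    have "positive_op (\<lambda>x. B ((B ^^ j) (B x)))"
      by (rule positive_op_conjugate[OF positive_opD(1,2)[OF B] less]) (simp add: 3)
    moreover have "B ^^ k = (\<lambda>x. B ((B ^^ j) (B x)))"
      by (simp add: 3 fun_eq_iff funpow_swap1)
    ultimately show ?thesis by simp
  next
    case 1
    then show ?thesis using positive_op_ident by (simp add: id_def)
  next
    case 2
    then show ?thesis using B by simp
  qed
qed

lemma nonneg_poly_positive:
  assumes B: "positive_op B" and p: "nonneg_poly B p"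
  shows "positive_op p"
proof -
  have "positive_op (\<lambda>x. (B ^^ k) (p x))" for k
    using p
  proof (induction arbitrary: k)
    case ident
    then show ?case using positive_op_funpow[OF B, of k] by simp
  next
    case (comp p)
    have "(B ^^ k) (B x) = (B ^^ Suc k) x" for x
      by (simp only: funpow_Suc_right comp_apply)
    then show ?case using comp.IH[of "Suc k"] by simp
  next
    case (add p q)
    then show ?case
      by (simp add: bounded_clinear_simps[OF positive_opD(1)[OF positive_op_funpow[OF B]]]
          positive_op_add)
  next
    case (scale p r)
    then show ?case
      by (simp add: bounded_clinear_simps[OF positive_opD(1)[OF positive_op_funpow[OF B]]]
          positive_op_scaleR)
  qed
  from this[of 0] show ?thesis by simp
qed

lemma nonneg_poly_compose:
  assumes "nonneg_poly B p" "nonneg_poly B q"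
  shows "nonneg_poly B (\<lambda>x. p (q x))"
  using assms
proof (induction p)
  case ident
  then show ?case .
next
  case (comp p)
  then show ?case using nonneg_poly.comp by blast
next
  case (add p p')
  then show ?case using nonneg_poly.add[of B "\<lambda>x. p (q x)" "\<lambda>x. p' (q x)"] by blast
next
  case (scale p r)
  then show ?case using nonneg_poly.scale[of B "\<lambda>x. p (q x)" r] by blast
qed

text \<open>
  The iteration of \<open>Y = (B + Y\<^sup>2) / 2\<close> from \<open>0\<close>. If \<open>T \<le> c\<close> with \<open>c > 0\<close> and \<open>B = 1 - T / c\<close>, a
  solution \<open>Y\<close> satisfies \<open>(1 - Y)\<^sup>2 = T / c\<close>, so that \<open>sqrt c\<close> times \<open>1 - Y\<close> is a root of \<open>T\<close>.
\<close>

primrec root_iter :: "('a::complex_hilbert \<Rightarrow> 'a) \<Rightarrow> nat \<Rightarrow> 'a \<Rightarrow> 'a" where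
  "root_iter B 0 = (\<lambda>x. 0)"
| "root_iter B (Suc n) = (\<lambda>x. (1/2) *\<^sub>R (B x + root_iter B n (root_iter B n x)))"

text \<open>
  The iterates increase. That the increments are not merely positive but polynomials with
  nonnegative coefficients is what the induction needs, since products of these are again such
  polynomials: from \<open>Y\<close> to \<open>Y + D\<close> the square grows by \<open>Y D + D Y + D\<^sup>2\<close>.
\<close>

lemma nonneg_poly_root_iter:
  assumes B: "positive_op B"
  shows "nonneg_poly B (root_iter B n) \<and>
    nonneg_poly B (\<lambda>x. root_iter B (Suc n) x - root_iter B n x)"
proof (induction n)
  case 0
  have "nonneg_poly B (\<lambda>x. 0 *\<^sub>R x)" "nonneg_poly B (\<lambda>x. (1/2) *\<^sub>R B x)"
    using nonneg_poly.scale[OF nonneg_poly.ident, of 0]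
      nonneg_poly.scale[OF nonneg_poly.comp[OF nonneg_poly.ident], of "1/2"] by auto
  then show ?case by simp
next
  case (Suc n)
  define Y where "Y = root_iter B n"
  define D where "D x = root_iter B (Suc n) x - Y x" for x
  have Y: "nonneg_poly B Y" using Suc by (simp add: Y_def)
  have D: "nonneg_poly B D" using Suc unfolding D_def[abs_def] Y_def by blast
  have Y_Suc: "root_iter B (Suc n) = (\<lambda>x. Y x + D x)"
    unfolding D_def by simp
  note simps = bounded_clinear_simps(1)[OF positive_opD(1)[OF nonneg_poly_positive[OF B Y]]]
    bounded_clinear_simps(1)[OF positive_opD(1)[OF nonneg_poly_positive[OF B D]]]
  have Y_Suc2: "root_iter B (Suc (Suc n)) x - root_iter B (Suc n) x =
      (1/2) *\<^sub>R ((Y (D x) + D (Y x)) + D (D x))" for x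
  proof -
    have "root_iter B (Suc (Suc n)) x = (1/2) *\<^sub>R (B x + (Y (Y x + D x) + D (Y x + D x)))"
      unfolding root_iter.simps(2)[of B "Suc n"] Y_Suc ..
    moreover have "root_iter B (Suc n) x = (1/2) *\<^sub>R (B x + Y (Y x))"
      by (simp add: Y_def)
    ultimately show ?thesis
      by (simp only: simps flip: scaleR_diff_right) simp
  qed
  have "nonneg_poly B (\<lambda>x. (1/2) *\<^sub>R ((Y (D x) + D (Y x)) + D (D x)))"
    by (rule nonneg_poly.scale[OF nonneg_poly.add[OF nonneg_poly.add]])
      (use Y D nonneg_poly_compose in auto)
  then show ?case
    unfolding Y_Suc2 unfolding Y_Suc using nonneg_poly.add[OF Y D] by blast
qed

text \<open>
  Commutation with every operator commuting with \<open>T\<close> passes from the iterates to the limit; the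
  uniqueness of the root depends on it.
\<close>

lemma positive_sqrt_exists:
  assumes T: "positive_op T"
  obtains S where "positive_op S" "S \<circ> S = T"
    "\<And>R x. bounded_clinear R \<Longrightarrow> (\<And>x. R (T x) = T (R x)) \<Longrightarrow> R (S x) = S (R x)"
proof -
  obtain c where c: "c > 0" "\<And>x. inner (T x) x \<le> c * (norm x)\<^sup>2"
    using positive_op_inner_bound[OF T] by blast
  define B where "B x = x - (1/c) *\<^sub>R T x" for x
  have "op_le (\<lambda>x. (1/c) *\<^sub>R T x) (\<lambda>x. x)"
    using c by (intro op_leI positive_op_scaleR positive_op_ident T)
      (simp_all add: field_simps power2_norm_eq_inner)
  then have B: "positive_op B" by (simp add: op_le_def B_def[abs_def])
  have B_le: "inner (B x) x \<le> 1 * (norm x)\<^sup>2" for x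
    using c(1) positive_opD(3)[OF T, of x]
    by (simp add: B_def inner_diff_left power2_norm_eq_inner)
  have contr: "norm (B x) \<le> norm x" for x
  proof -
    have "(norm (B x))\<^sup>2 \<le> (norm x)\<^sup>2"
      using positive_op_norm_le[OF B _ B_le, of x] B_le[of x] by linarith
    then show ?thesis by (rule power2_le_imp_le) simp
  qed
  define Y where "Y = root_iter B"
  have Y: "positive_op (Y n)" for n
    using nonneg_poly_positive[OF B] nonneg_poly_root_iter[OF B, of n] by (simp add: Y_def)
  have norm_Y: "norm (Y n x) \<le> norm x" for n x
  proof (induction n arbitrary: x)
    case (Suc n)
    have "norm (B x + Y n (Y n x)) \<le> norm x + norm x"
      by (intro norm_triangle_mono contr order_trans[OF Suc Suc])
    then show ?case by (simp add: Y_def)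
  qed (simp add: Y_def)
  have Y_le: "inner (Y n x) x \<le> 1 * (norm x)\<^sup>2" for n x
    using norm_cauchy_schwarz[of "Y n x" x] mult_right_mono[OF norm_Y[of n x], of "norm x"]
    by (simp add: power2_eq_square)
  obtain L where L: "positive_op L" "\<And>x. (\<lambda>n. Y n x) \<longlonglongrightarrow> L x"
  proof (rule increasing_positive_op_limit[OF Y _ _ Y_le])
    show "op_le (Y n) (Y (Suc n))" for n
      using nonneg_poly_positive[OF B] nonneg_poly_root_iter[OF B, of n]
      by (simp add: Y_def op_le_def)
  qed auto
  have L_le: "inner (L x) x \<le> inner x x" for x
    using LIMSEQ_le_const2[OF tendsto_inner[OF L(2)[of x] tendsto_const[of x]]] Y_le
    by (simp add: power2_norm_eq_inner)
  have YY: "(\<lambda>n. Y n (Y n x)) \<longlonglongrightarrow> L (L x)" for x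
  proof -
    have "(\<lambda>n. Y n (Y n x - L x)) \<longlonglongrightarrow> 0"
    proof (rule Lim_null_comparison)
      show "(\<lambda>n. norm (Y n x - L x)) \<longlonglongrightarrow> 0"
        using L(2)[of x] by (simp add: LIM_zero tendsto_norm_zero)
    qed (simp add: norm_Y)
    from tendsto_add[OF this L(2)[of "L x"]] show ?thesis
      by (simp add: bounded_clinear_simps(2)[OF positive_opD(1)[OF Y]])
  qed
  have fixpoint: "L x = (1/2) *\<^sub>R (B x + L (L x))" for x
  proof (rule LIMSEQ_unique)
    show "(\<lambda>n. Y (Suc n) x) \<longlonglongrightarrow> L x"
      using L(2)[of x] by (rule LIMSEQ_Suc)
    show "(\<lambda>n. Y (Suc n) x) \<longlonglongrightarrow> (1/2) *\<^sub>R (B x + L (L x))"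
      using YY[of x] unfolding Y_def root_iter.simps by (intro tendsto_intros)
  qed
  define S where "S x = sqrt c *\<^sub>R (x - L x)" for x
  have "op_le L (\<lambda>x. x)"
    by (intro op_leI L positive_op_ident L_le)
  then have "positive_op S"
    using c(1) by (simp add: op_le_def S_def[abs_def] positive_op_scaleR)
  moreover have "S \<circ> S = T"
  proof
    fix x
    note simps = bounded_clinear_simps[OF positive_opD(1)[OF L(1)]]
    have "(S \<circ> S) x = (sqrt c * sqrt c) *\<^sub>R ((x - L x) - (L x - L (L x)))"
      by (simp only: comp_apply S_def simps scaleR_scaleR flip: scaleR_diff_right)
    also have "(x - L x) - (L x - L (L x)) = x - 2 *\<^sub>R L x + L (L x)"
      by (simp add: scaleR_2)
    also have "2 *\<^sub>R L x = B x + L (L x)"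
      using arg_cong[OF fixpoint[of x], of "\<lambda>v. 2 *\<^sub>R v"] by simp
    finally show "(S \<circ> S) x = T x"
      using c(1) by (simp add: B_def)
  qed
  moreover have "R (S x) = S (R x)" if R: "bounded_clinear R" and comm: "\<And>x. R (T x) = T (R x)"
    for R x
  proof -
    note simps = bounded_clinear_simps[OF R]
    have RB: "R (B x) = B (R x)" for x by (simp add: B_def simps comm)
    have RY: "R (Y n x) = Y n (R x)" for n x
      by (induction n arbitrary: x) (simp_all add: Y_def simps RB)
    have "R (L x) = L (R x)"
      using LIMSEQ_unique[OF bounded_linear.tendsto[OF bounded_clinearD(1)[OF R] L(2)[of x]]]
        L(2)[of "R x"] by (simp add: RY)
    then show ?thesis by (simp add: S_def simps)
  qed
  ultimately show ?thesis using that by blast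
qed

text \<open>
  Uniqueness of the positive root: if \<open>R\<close> and the root \<open>S\<close> constructed above have the same square,
  they commute, so \<open>S + R\<close> annihilates the range of \<open>S - R\<close>; then so do \<open>S\<close> and \<open>R\<close>
  separately, and \<open>(S - R)\<^sup>2 = 0\<close>.
\<close>

lemma op_sqrt:
  assumes T: "positive_op T"
  shows "positive_op (op_sqrt T)" "op_sqrt T (op_sqrt T x) = T x"
proof -
  obtain S where S: "positive_op S" "S \<circ> S = T"
    and comm: "\<And>R x. bounded_clinear R \<Longrightarrow> (\<And>x. R (T x) = T (R x)) \<Longrightarrow> R (S x) = S (R x)"
    by (rule positive_sqrt_exists[OF T]) blast
  have unique: "R = S" if R: "positive_op R" "R \<circ> R = T" for R
  proof
    fix x
    have T_R: "T x = R (R x)" for x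
      using fun_cong[OF R(2), of x] by simp
    have T_S: "T x = S (S x)" for x
      using fun_cong[OF S(2), of x] by simp
    have RS: "R (S x) = S (R x)" for x
      by (rule comm[OF positive_opD(1)[OF R(1)]]) (simp only: T_R)
    define y where "y = S x - R x"
    have "S y + R y = T x - T x"
      unfolding y_def bounded_clinear_simps(2)[OF positive_opD(1)[OF S(1)]]
        bounded_clinear_simps(2)[OF positive_opD(1)[OF R(1)]] RS
      using T_R[of x] T_S[of x] by simp
    then have "inner (S y + R y) y = 0"
      by simp
    then have "inner (S y) y = 0" "inner (R y) y = 0"
      using positive_opD(3)[OF S(1), of y] positive_opD(3)[OF R(1), of y]
      by (simp_all add: inner_add_left)
    then have "S y = 0" "R y = 0"
      using positive_op_kernel[OF S(1)] positive_op_kernel[OF R(1)] by blast+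
    have "inner y y = inner (S x) y - inner (R x) y"
      by (simp only: y_def inner_diff_left)
    also have "\<dots> = inner x (S y) - inner x (R y)"
      by (simp only: positive_opD(2)[OF S(1)] positive_opD(2)[OF R(1)])
    also have "\<dots> = 0"
      by (simp only: \<open>S y = 0\<close> \<open>R y = 0\<close>)
    finally show "R x = S x" by (simp add: y_def)
  qed
  have "op_sqrt T = S"
    unfolding op_sqrt_def
  proof (rule the_equality)
    show "positive_op S \<and> S \<circ> S = T" using S by blast
    show "R = S" if "positive_op R \<and> R \<circ> R = T" for R
      using that unique by blast
  qed
  then show "positive_op (op_sqrt T)" "op_sqrt T (op_sqrt T x) = T x"
    using S(1) fun_cong[OF S(2), of x] by simp_all
qed

section \<open>Edge contractions\<close>

lemma closure_range_add:
  assumes R: "bounded_clinear R" and "x \<in> closure (range R)" "y \<in> closure (range R)"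
  shows "x + y \<in> closure (range R)"
proof -
  obtain f where f: "(\<forall>n. f n \<in> range R) \<and> f \<longlonglongrightarrow> x"
    using assms(2) unfolding closure_sequential ..
  obtain g where g: "(\<forall>n. g n \<in> range R) \<and> g \<longlonglongrightarrow> y"
    using assms(3) unfolding closure_sequential ..
  have "f n + g n \<in> range R" for n
  proof -
    obtain a b where "f n = R a" "g n = R b" using f g by blast
    then have "f n + g n = R (a + b)" by (simp only: bounded_clinear_simps(1)[OF R])
    then show ?thesis by blast
  qed
  moreover have "(\<lambda>n. f n + g n) \<longlonglongrightarrow> x + y"
    using f g by (intro tendsto_add) simp_all
  ultimately show ?thesis
    unfolding closure_sequential by (intro exI[of _ "\<lambda>n. f n + g n"] conjI allI)
qed

lemma closure_range_scaleC:
  assumes R: "bounded_clinear R" and "x \<in> closure (range R)"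
  shows "a *\<^sub>C x \<in> closure (range R)"
proof -
  obtain f where f: "(\<forall>n. f n \<in> range R) \<and> f \<longlonglongrightarrow> x"
    using assms(2) unfolding closure_sequential ..
  have "a *\<^sub>C f n \<in> range R" for n
  proof -
    obtain b where "f n = R b" using f by blast
    then have "a *\<^sub>C f n = R (a *\<^sub>C b)" by (simp only: bounded_clinearD(3)[OF R])
    then show ?thesis by blast
  qed
  moreover have "(\<lambda>n. a *\<^sub>C f n) \<longlonglongrightarrow> a *\<^sub>C x"
    using f by (intro bounded_linear.tendsto[OF bounded_linear_scaleC]) simp
  ultimately show ?thesis
    unfolding closure_sequential by (intro exI[of _ "\<lambda>n. a *\<^sub>C f n"] conjI allI)
qed

lemma ocompl_closure_rangeI:
  assumes R: "bounded_clinear R" and u: "\<And>h. inner (R h) u = 0"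
  shows "u \<in> ocompl (closure (range R))"
proof -
  have 0: "inner v u = 0" if "v \<in> closure (range R)" for v
    using that by (rule inner_zero_closure) (auto simp: u)
  have "cinner u v = 0" if "v \<in> closure (range R)" for v
    using 0[OF that] 0[OF closure_range_scaleC[OF R that, of \<i>]]
    unfolding cinner_eq_Complex inner_commute[of u] by (simp add: complex_eq_iff)
  then show ?thesis by (simp add: ocompl_def)
qed

text \<open>
  A form of Douglas' factorization lemma. The relative Riesz theorem, applied to
  \<open>h \<mapsto> inner (S h) y\<close>, produces a contraction \<open>D\<close> with \<open>R\<^sup>* D = S\<^sup>*\<close> and values in the
  closure of the range of \<open>R\<close>; the required contraction is the adjoint of \<open>D\<close>.
\<close>

lemma range_contraction_exists:
  fixes R S :: "'b::complex_inner \<Rightarrow> 'a::complex_hilbert"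
  assumes R: "bounded_clinear R" and S: "bounded_clinear S"
    and dom: "\<And>h. norm (S h) \<le> norm (R h)"
  shows "\<exists>C. op_between (closure (range R)) (closure (range S)) C \<and>
    (\<forall>x. norm (C x) \<le> norm x) \<and> (\<forall>h. C (R h) = S h)"
proof -
  have "\<exists>z. z \<in> closure (range R) \<and> (\<forall>h. inner (R h) z = inner (S h) y)" for y
  proof -
    have lin: "linear (\<lambda>h. inner (S h) y)"
      by (intro linearI) (simp_all add: bounded_clinear_simps[OF S] inner_add_left)
    have "inner (S h) y \<le> norm y * norm (R h)" for h
      using norm_cauchy_schwarz[of "S h" y] mult_right_mono[OF dom[of h], of "norm y"]
      by (simp add: mult.commute)
    from riesz_closure_range[OF bounded_clinearD(2)[OF R] lin this] show ?thesis by blast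
  qed
  then have "\<exists>D. \<forall>y. D y \<in> closure (range R) \<and> (\<forall>h. inner (R h) (D y) = inner (S h) y)"
    by (intro choice) blast
  then obtain D where D: "\<And>y. D y \<in> closure (range R)" "\<And>y h. inner (R h) (D y) = inner (S h) y"
    by blast
  have D_eqI: "D y = z" if "z \<in> closure (range R)" "\<And>h. inner (R h) z = inner (S h) y" for y z
    by (rule closure_range_eqI[OF D(1) that(1)]) (simp add: D(2) that(2))
  have D_norm: "norm (D y) \<le> norm y" for y
  proof -
    have "closure (range R) \<subseteq> {z. inner z (D y) \<le> norm z * norm y}"
    proof (rule closure_minimal)
      have "inner (R h) (D y) \<le> norm (R h) * norm y" for h
        unfolding D(2) using norm_cauchy_schwarz[of "S h" y]
          mult_right_mono[OF dom[of h], of "norm y"] by simp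
      then show "range R \<subseteq> {z. inner z (D y) \<le> norm z * norm y}" by blast
      show "closed {z. inner z (D y) \<le> norm z * norm y}"
        by (intro closed_Collect_le continuous_intros)
    qed
    then have "inner (D y) (D y) \<le> norm (D y) * norm y" using D(1) by blast
    then show ?thesis
      by (cases "D y = 0") (auto simp: power2_norm_eq_inner[symmetric] power2_eq_square)
  qed
  have D_lin: "bounded_clinear D"
  proof (rule bounded_clinearI)
    show "D (x + y) = D x + D y" for x y
      by (rule D_eqI) (auto simp: D inner_add_right intro: closure_range_add[OF R])
    show "D (a *\<^sub>C x) = a *\<^sub>C D x" for a x
    proof (rule D_eqI)
      show "inner (R h) (a *\<^sub>C D x) = inner (S h) (a *\<^sub>C x)" for h
      proof -
        have "inner (R h) (a *\<^sub>C D x) = inner (R (cnj a *\<^sub>C h)) (D x)"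
          unfolding bounded_clinearD(3)[OF R] inner_scaleC_left by simp
        also have "\<dots> = inner (S h) (a *\<^sub>C x)"
          unfolding D(2) bounded_clinearD(3)[OF S] inner_scaleC_left by simp
        finally show ?thesis .
      qed
    qed (rule closure_range_scaleC[OF R D(1)])
    show "norm (D y) \<le> norm y * 1" for y
      using D_norm[of y] by simp
  qed
  define C where "C = cadjoint D"
  have C: "inner v (C y) = inner (D v) y" for v y
    unfolding C_def by (rule cadjoint_inner[OF D_lin])
  have C_lin: "bounded_clinear C"
    using bounded_clinear_adjoint[OF D_lin C] .
  have C_R: "C (R h) = S h" for h
  proof -
    have "inner v (C (R h)) = inner v (S h)" for v
      using C[of v "R h"] D(2)[of h v] by (simp only: inner_commute)
    then show ?thesis using vector_eq_ldot[of "C (R h)" "S h"] by blast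
  qed
  have C_range: "C x \<in> closure (range S)" for x
  proof -
    obtain z u where zu: "C x = z + u" "z \<in> closure (range S)" "\<And>h. inner (S h) u = 0"
      using closure_range_decomp[OF bounded_clinearD(2)[OF S]] by blast
    \<comment> \<open>\<open>C x\<close> is orthogonal to the kernel of \<open>D\<close>, which contains the component \<open>u\<close>.\<close>
    have "0 \<in> closure (range R)"
      using rangeI[of R 0] closure_subset bounded_clinear_simps(3)[OF R] by fastforce
    then have "D u = 0"
      by (rule D_eqI) (simp add: zu(3))
    then have "inner u (z + u) = 0"
      using C[of u x] zu(1) by simp
    moreover have "inner z u = 0"
      using zu(2) by (rule inner_zero_closure) (auto simp: zu(3))
    ultimately have "u = 0"
      by (simp add: inner_add_right inner_commute)
    then show ?thesis using zu by simp
  qed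
  have C_ocompl: "C x = 0" if "x \<in> ocompl (closure (range R))" for x
  proof -
    have "inner (D v) x = 0" for v
    proof -
      have "cinner x (D v) = 0" using that D(1)[of v] by (simp add: ocompl_def)
      then have "inner x (D v) = 0" by (simp add: inner_eq_Re_cinner)
      then show ?thesis by (simp add: inner_commute)
    qed
    then have "inner (C x) (C x) = 0" by (simp only: C)
    then show ?thesis by simp
  qed
  have C_norm: "norm (C x) \<le> norm x" for x
  proof -
    have "norm (C x) * norm (C x) = inner (D (C x)) x"
      by (simp add: power2_norm_eq_inner flip: C power2_eq_square)
    also have "\<dots> \<le> norm (C x) * norm x"
      using norm_cauchy_schwarz[of "D (C x)" x] mult_right_mono[OF D_norm[of "C x"], of "norm x"]
      by simp
    finally show ?thesis
      by (cases "C x = 0") auto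
  qed
  show ?thesis
    using C_lin C_range C_ocompl C_norm C_R by (auto simp: op_between_def)
qed


lemma range_contraction_unique:
  fixes R S :: "'b::complex_inner \<Rightarrow> 'a::complex_hilbert"
  assumes R: "bounded_clinear R"
    and C: "op_between (closure (range R)) V C" "\<And>h. C (R h) = S h"
    and C': "op_between (closure (range R)) V C'" "\<And>h. C' (R h) = S h"
  shows "C = C'"
proof
  fix x
  have lin: "bounded_clinear C" "bounded_clinear C'"
    using C(1) C'(1) by (simp_all add: op_between_def)
  obtain z u where zu: "x = z + u" "z \<in> closure (range R)" "\<And>h. inner (R h) u = 0"
    using closure_range_decomp[OF bounded_clinearD(2)[OF R]] by blast
  have "u \<in> ocompl (closure (range R))"
    by (rule ocompl_closure_rangeI[OF R zu(3)])
  then have "C u = 0" "C' u = 0"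
    using C(1) C'(1) by (simp_all add: op_between_def)
  moreover have "closure (range R) \<subseteq> {z. C z = C' z}"
  proof (rule closure_minimal)
    show "closed {z. C z = C' z}"
      using lin[THEN bounded_clinearD(1)]
      by (intro closed_Collect_eq linear_continuous_on)
  qed (auto simp: C C')
  then have "C z = C' z" using zu(2) by blast
  ultimately show "C x = C' x"
    by (simp add: zu(1) bounded_clinear_simps(1)[OF lin(1)] bounded_clinear_simps(1)[OF lin(2)])
qed

section \<open>Words and positive operator valued measures\<close>

lemma words_len_0: "words_len m 0 = {[]}"
  by (auto simp: words_len_def words_def)

lemma words_len_Suc: "words_len m (Suc n) = (\<lambda>(w, j). w @ [j]) ` (words_len m n \<times> {..<m})"
proof (intro subset_antisym subsetI)
  fix v assume v: "v \<in> words_len m (Suc n)"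
  then obtain w j where "v = w @ [j]"
    by (cases v rule: rev_cases) (auto simp: words_len_def)
  with v show "v \<in> (\<lambda>(w, j). w @ [j]) ` (words_len m n \<times> {..<m})"
    by (auto simp: words_len_def words_def)
qed (auto simp: words_len_def words_def)

lemma sum_words_len_Suc:
  "(\<Sum>v\<in>words_len m (Suc n). f v) = (\<Sum>w\<in>words_len m n. \<Sum>j<m. f (w @ [j]))"
  unfolding words_len_Suc
  by (subst sum.reindex) (auto simp: inj_on_def sum.cartesian_product case_prod_beta intro!: sum.cong)

lemma cylinder_Nil: "cylinder m [] = space (Omega m)"
  by (simp add: cylinder_def)

lemma cylinder_sets: "cylinder m w \<in> sets (Omega m)"
proof -
  have "cylinder m w = space (Omega m) \<inter> (\<Inter>i\<in>{..<length w}. {x \<in> space (Omega m). x i = w ! i})"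
    by (auto simp: cylinder_def)
  moreover have "{x \<in> space (Omega m). x i = w ! i} \<in> sets (Omega m)" for i
  proof -
    have "(\<lambda>x. x i) \<in> measurable (Omega m) (count_space {..<m})"
      unfolding Omega_def by (rule measurable_component_singleton) simp
    from measurable_sets[OF this, of "{w ! i} \<inter> {..<m}"]
    have "(\<lambda>x. x i) -` ({w ! i} \<inter> {..<m}) \<inter> space (Omega m) \<in> sets (Omega m)" by simp
    also have "(\<lambda>x. x i) -` ({w ! i} \<inter> {..<m}) \<inter> space (Omega m) = {x \<in> space (Omega m). x i = w ! i}"
      by (auto simp: Omega_def space_PiM PiE_def Pi_def)
    finally show ?thesis .
  qed
  ultimately show ?thesis
    by (cases "w = []") (auto intro!: sets.Int sets.finite_INT)
qed

lemma cylinder_split: "cylinder m w = (\<Union>j<m. cylinder m (w @ [j]))"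
proof (intro subset_antisym subsetI)
  fix x assume x: "x \<in> cylinder m w"
  then have "x (length w) < m"
    by (auto simp: cylinder_def Omega_def space_PiM PiE_def Pi_def)
  moreover have "x \<in> cylinder m (w @ [x (length w)])"
    using x by (auto simp: cylinder_def nth_append less_Suc_eq)
  ultimately show "x \<in> (\<Union>j<m. cylinder m (w @ [j]))" by blast
next
  fix x assume "x \<in> (\<Union>j<m. cylinder m (w @ [j]))"
  then show "x \<in> cylinder m w"
    by (auto simp: cylinder_def nth_append less_Suc_eq split: if_splits)
qed

lemma cylinder_append_disjoint:
  assumes "i \<noteq> j" shows "cylinder m (w @ [i]) \<inter> cylinder m (w @ [j]) = {}"
proof -
  have "x (length w) = k" if "x \<in> cylinder m (w @ [k])" for x k
    using that by (auto simp: cylinder_def dest!: spec[of _ "length w"])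
  then show ?thesis using assms by blast
qed

lemma povm_positive: "povm m E \<Longrightarrow> positive_op (E (cylinder m w))"
  using cylinder_sets by (auto simp: povm_def)

lemma povm_cylinder_split:
  assumes E: "povm m E"
  shows "inner (E (cylinder m w) x) x = (\<Sum>j<m. inner (E (cylinder m (w @ [j])) x) x)"
proof -
  have add: "(\<lambda>k. cinner (E (A k) x) y) sums cinner (E (\<Union>k. A k) x) y"
    if "range A \<subseteq> sets (Omega m)" "disjoint_family A" for A :: "nat \<Rightarrow> _" and x y
    using E that unfolding povm_def by blast
  \<comment> \<open>Countable additivity on the constant family of empty sets gives a convergent constant series.\<close>
  have empty: "cinner (E {} x) x = 0"
  proof -
    have "(\<lambda>k::nat. cinner (E {} x) x) sums cinner (E {} x) x"
      using add[of "\<lambda>_. {}" x x] by (simp add: disjoint_family_on_def)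
    then have "(\<lambda>k::nat. cinner (E {} x) x) \<longlonglongrightarrow> 0"
      by (intro summable_LIMSEQ_zero) (rule sums_summable)
    then show ?thesis by (simp add: LIMSEQ_const_iff)
  qed
  define A where "A k = (if k < m then cylinder m (w @ [k]) else {})" for k
  have "(\<lambda>k. cinner (E (A k) x) x) sums cinner (E (\<Union>k. A k) x) x"
  proof (rule add)
    show "range A \<subseteq> sets (Omega m)"
      by (auto simp: A_def cylinder_sets)
    show "disjoint_family A"
      by (simp add: disjoint_family_on_def A_def cylinder_append_disjoint)
  qed
  moreover have "(\<Union>k. A k) = cylinder m w"
    unfolding cylinder_split[of m w] A_def by (auto split: if_splits)
  moreover have "(\<lambda>k. cinner (E (A k) x) x) sums (\<Sum>k<m. cinner (E (A k) x) x)"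
    by (rule sums_finite) (auto simp: A_def empty)
  ultimately have "cinner (E (cylinder m w) x) x = (\<Sum>k<m. cinner (E (A k) x) x)"
    using sums_unique2 by metis
  then show ?thesis
    by (simp add: inner_eq_Re_cinner A_def)
qed

lemma E_root_positive: "povm m E \<Longrightarrow> positive_op (E_root m E w)"
  unfolding E_root_def by (intro op_sqrt povm_positive)

lemma E_root_norm:
  assumes E: "povm m E"
  shows "(norm (E_root m E w h))\<^sup>2 = inner (E (cylinder m w) h) h"
proof -
  have "(norm (E_root m E w h))\<^sup>2 = inner (E_root m E w (E_root m E w h)) h"
    unfolding power2_norm_eq_inner positive_opD(2)[OF E_root_positive[OF E]] ..
  then show ?thesis
    unfolding E_root_def op_sqrt(2)[OF povm_positive[OF E]] .
qed

lemma E_root_norm_split: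
  assumes E: "povm m E"
  shows "(norm (E_root m E w h))\<^sup>2 = (\<Sum>j<m. (norm (E_root m E (w @ [j]) h))\<^sup>2)"
  unfolding E_root_norm[OF E] by (rule povm_cylinder_split[OF E])

lemma E_root_Nil:
  assumes E: "povm m E"
  shows "E_root m E [] h = h"
proof -
  have eq: "E (cylinder m []) = (\<lambda>x. x)"
    using E by (simp add: povm_def cylinder_Nil id_def)
  define S where "S = E_root m E []"
  have S: "positive_op S"
    unfolding S_def by (rule E_root_positive[OF E])
  have S_S: "S (S x) = x" for x
    using op_sqrt(2)[OF povm_positive[OF E], of "[]" x] by (simp add: S_def E_root_def eq)
  \<comment> \<open>\<open>S\<close> acts as \<open>-1\<close> on \<open>S h - h\<close>, which positivity forbids unless \<open>S h = h\<close>.\<close>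
  define y where "y = S h - h"
  have "S y = - y"
    by (simp add: y_def bounded_clinear_simps(2)[OF positive_opD(1)[OF S]] S_S)
  then have "inner y y \<le> 0"
    using positive_opD(3)[OF S, of y] by simp
  then have "y = 0"
    using inner_gt_zero_iff[of y] by linarith
  then show ?thesis by (simp add: y_def S_def)
qed

lemma sum_E_root_norm:
  assumes E: "povm m E"
  shows "(\<Sum>w\<in>words_len m n. (norm (E_root m E w h))\<^sup>2) = (norm h)\<^sup>2"
proof (induction n)
  case 0
  then show ?case by (simp add: words_len_0 E_root_Nil[OF E])
next
  case (Suc n)
  then show ?case by (simp add: sum_words_len_Suc flip: E_root_norm_split[OF E])
qed

lemma edge_contraction:
  assumes E: "povm m E" and j: "j < m"
  shows "op_between (H_space m E w) (H_space m E (w @ [j])) (edge_contraction m E w j)"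
    and "edge_contraction m E w j (E_root m E w h) = E_root m E (w @ [j]) h"
proof -
  let ?P = "\<lambda>C. op_between (H_space m E w) (H_space m E (w @ [j])) C \<and>
      (\<forall>x. norm (C x) \<le> norm x) \<and> (\<forall>h. C (E_root m E w h) = E_root m E (w @ [j]) h)"
  have dom: "norm (E_root m E (w @ [j]) h) \<le> norm (E_root m E w h)" for h
  proof (rule power2_le_imp_le)
    show "(norm (E_root m E (w @ [j]) h))\<^sup>2 \<le> (norm (E_root m E w h))\<^sup>2"
      unfolding E_root_norm_split[OF E, of w h]
      using j by (intro member_le_sum) auto
  qed simp
  note lin = positive_opD(1)[OF E_root_positive[OF E]]
  have "\<exists>C. ?P C"
    unfolding H_space_def by (rule range_contraction_exists[OF lin lin dom])
  then obtain C where C: "?P C" ..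
  have "\<exists>!C. ?P C"
  proof (rule ex1I)
    show "?P C" by (rule C)
    show "C' = C" if C': "?P C'" for C'
    proof (rule range_contraction_unique[OF lin[of w]])
      show "op_between (closure (range (E_root m E w))) (H_space m E (w @ [j])) C'"
        using C' unfolding H_space_def by blast
      show "op_between (closure (range (E_root m E w))) (H_space m E (w @ [j])) C"
        using C unfolding H_space_def by blast
      show "C' (E_root m E w h) = E_root m E (w @ [j]) h" for h
        using C' by blast
      show "C (E_root m E w h) = E_root m E (w @ [j]) h" for h
        using C by blast
    qed
  qed
  from theI'[OF this] show
    "op_between (H_space m E w) (H_space m E (w @ [j])) (edge_contraction m E w j)"
    "edge_contraction m E w j (E_root m E w h) = E_root m E (w @ [j]) h"
    unfolding edge_contraction_def by blast+
qed

lemma edge_contraction_clinear: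
  "povm m E \<Longrightarrow> j < m \<Longrightarrow> bounded_clinear (edge_contraction m E w j)"
  using edge_contraction(1) by (auto simp: op_between_def)

lemma E_root_cadjoint_edge:
  assumes E: "povm m E" and j: "j < m"
  shows "E_root m E w (cadjoint (edge_contraction m E w j) y) = E_root m E (w @ [j]) y"
proof -
  have "inner v (E_root m E w (cadjoint (edge_contraction m E w j) y)) =
      inner v (E_root m E (w @ [j]) y)" for v
    using cadjoint_inner[OF edge_contraction_clinear[OF E j], of "E_root m E w v" w y]
      edge_contraction(2)[OF E j, of w v]
      positive_opD(2)[OF E_root_positive[OF E], of w v]
      positive_opD(2)[OF E_root_positive[OF E], of "w @ [j]" v] by simp
  then show ?thesis
    using vector_eq_ldot by blast
qed

text \<open>
  The edge contractions at \<open>w\<close> are jointly isometric on \<open>H_w\<close>: on the range of the root this is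
  additivity of the measure, and both sides are continuous.
\<close>

lemma sum_edge_contraction_norm:
  assumes E: "povm m E" and x: "x \<in> H_space m E w"
  shows "(\<Sum>j<m. (norm (edge_contraction m E w j x))\<^sup>2) = (norm x)\<^sup>2"
proof -
  let ?A = "{x. (\<Sum>j<m. (norm (edge_contraction m E w j x))\<^sup>2) = (norm x)\<^sup>2}"
  have "H_space m E w \<subseteq> ?A"
    unfolding H_space_def
  proof (rule closure_minimal)
    show "range (E_root m E w) \<subseteq> ?A"
      using edge_contraction(2)[OF E] E_root_norm_split[OF E, of w] by auto
    show "closed ?A"
      using bounded_clinearD(1)[OF edge_contraction_clinear[OF E]]
      by (intro closed_Collect_eq continuous_intros linear_continuous_on) auto
  qed
  then show ?thesis using x by blast
qed

section \<open>Square operators of a range martingale\<close>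

lemma cinner_sum_right:
  "cinner v (\<Sum>i\<in>I. f i) = (\<Sum>i\<in>I. cinner v (f i :: 'a::complex_inner))"
proof (induction I rule: infinite_finite_induct)
  case (insert i I)
  have "cinner v (x + y) = cinner v x + cinner v y" for x y :: 'a
    unfolding cinner_eq_Complex by (simp add: complex_eq_iff scaleC_add_right inner_add_right)
  with insert show ?case by simp
qed (simp_all add: cinner_eq_Complex scaleC_zero_right complex_eq_iff)

lemma J_iter_eq:
  assumes E: "povm m E"
  shows "J_iter m E n h v = (if v \<in> words_len m n then E_root m E v h else 0)"
proof (induction n arbitrary: v)
  case 0
  then show ?case by (simp add: words_len_0 E_root_Nil[OF E])
next
  case (Suc n)
  show ?case
  proof (cases "v \<in> words_len m (Suc n)")
    case True
    then obtain w j where v: "v = w @ [j]" "w \<in> words_len m n" "j < m"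
      unfolding words_len_Suc by auto
    with True show ?thesis
      by (simp add: J_step_def Suc edge_contraction(2)[OF E])
  qed (simp add: J_step_def)
qed

lemma cadjoint_wrt_J_iter:
  assumes E: "povm m E"
  shows "cadjoint_wrt (K_inner m n) (J_iter m E n) y = (\<Sum>w\<in>words_len m n. E_root m E w (y w))"
    (is "_ = ?z")
  unfolding cadjoint_wrt_def
proof (rule the_equality)
  have "K_inner m n (J_iter m E n v) y = (\<Sum>w\<in>words_len m n. cinner (E_root m E w v) (y w))" for v
    by (simp add: K_inner_def J_iter_eq[OF E])
  moreover have "cinner v (E_root m E w u) = cinner (E_root m E w v) u" for v u w
    by (rule cinner_eq_if_inner_eq)
      (simp_all add: positive_opD[OF E_root_positive[OF E]])
  ultimately show z: "\<forall>v. cinner v ?z = K_inner m n (J_iter m E n v) y"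
    by (simp add: cinner_sum_right)
  show "x = ?z" if "\<forall>v. cinner v x = K_inner m n (J_iter m E n v) y" for x
  proof -
    have "inner v x = inner v ?z" for v
      using that z by (simp only: inner_eq_Re_cinner)
    then show ?thesis using vector_eq_ldot by blast
  qed
qed

lemma square_op_eq:
  assumes E: "povm m E"
  shows "square_op m E X n h =
    (\<Sum>w\<in>words_len m n. E_root m E w (X w (X w (E_root m E w h))))"
  by (simp add: square_op_def cadjoint_wrt_J_iter[OF E] diag_op_def J_iter_eq[OF E])

text \<open>
  The edge contraction carries the root of \<open>E_w\<close> to that of \<open>E_wj\<close>, and its adjoint followed by
  the root of \<open>E_w\<close> is the root of \<open>E_wj\<close>. Hence the terms of level \<open>n + 1\<close>, grouped by parent
  word, are the first halves of the local variances.
\<close>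

lemma square_op_Suc_diff:
  assumes E: "povm m E"
  shows "square_op m E X (Suc n) h - square_op m E X n h =
    (\<Sum>w\<in>words_len m n. E_root m E w (local_variance m E X w (E_root m E w h)))"
proof -
  have "E_root m E w (local_variance m E X w (E_root m E w h)) =
      (\<Sum>j<m. E_root m E (w @ [j]) (X (w @ [j]) (X (w @ [j]) (E_root m E (w @ [j]) h))))
      - E_root m E w (X w (X w (E_root m E w h)))" for w
  proof -
    note simps = bounded_clinear_simps[OF positive_opD(1)[OF E_root_positive[OF E, of w]]]
    show ?thesis
      unfolding local_variance_def simps
      by (simp add: E_root_cadjoint_edge[OF E] edge_contraction(2)[OF E])
  qed
  then show ?thesis
    unfolding square_op_eq[OF E] sum_words_len_Suc by (simp add: sum_subtractf)
qed

lemma range_martingaleD: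
  assumes X: "bounded_sa_range_martingale m E X" and w: "w \<in> words m"
  shows "bounded_clinear (X w)" "inner (X w x) y = inner x (X w y)" "X w x \<in> H_space m E w"
    "X w x = (\<Sum>j<m. cadjoint (edge_contraction m E w j)
                  (X (w @ [j]) (edge_contraction m E w j x)))"
    "norm (X w x) \<le> (SUP w\<in>words m. onorm (X w)) * norm x"
proof -
  show lin: "bounded_clinear (X w)" and "X w x \<in> H_space m E w"
    using X w by (auto simp: bounded_sa_range_martingale_def op_between_def)
  have "cadjoint (X w) = X w"
    using X w unfolding bounded_sa_range_martingale_def by blast
  with cadjoint_inner[OF lin, of x y] show "inner (X w x) y = inner x (X w y)"
    by simp
  show "X w x = (\<Sum>j<m. cadjoint (edge_contraction m E w j)
                  (X (w @ [j]) (edge_contraction m E w j x)))"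
    using X w unfolding bounded_sa_range_martingale_def by blast
  have "onorm (X w) \<le> (SUP w\<in>words m. onorm (X w))"
    using X w unfolding bounded_sa_range_martingale_def by (intro cSUP_upper) auto
  from mult_right_mono[OF this norm_ge_zero[of x]]
  show "norm (X w x) \<le> (SUP w\<in>words m. onorm (X w)) * norm x"
    using onorm[OF bounded_clinearD(1)[OF lin], of x] by linarith
qed

text \<open>
  The local variance is nonnegative. Since \<open>X w\<close> maps into \<open>H_w\<close>, where the edge contractions are
  jointly isometric, expanding the sum over \<open>j\<close> of \<open>(norm (X_wj (C_wj x) - C_wj (X_w x)))\<^sup>2\<close> with
  the martingale equation leaves exactly the difference of the two sides.
\<close>

lemma norm_martingale_le:
  assumes E: "povm m E" and X: "bounded_sa_range_martingale m E X" and w: "w \<in> words m"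
  shows "(norm (X w x))\<^sup>2 \<le> (\<Sum>j<m. (norm (X (w @ [j]) (edge_contraction m E w j x)))\<^sup>2)"
proof -
  define C where "C = edge_contraction m E w"
  define Y where "Y j = X (w @ [j]) (C j x)" for j
  have "0 \<le> (\<Sum>j<m. (norm (Y j - C j (X w x)))\<^sup>2)"
    by (simp add: sum_nonneg)
  also have "\<dots> = (\<Sum>j<m. (norm (Y j))\<^sup>2) - 2 * (\<Sum>j<m. inner (C j (X w x)) (Y j))
      + (\<Sum>j<m. (norm (C j (X w x)))\<^sup>2)"
    by (simp add: power2_norm_eq_inner inner_diff_left inner_diff_right inner_commute
        sum_subtractf sum.distrib sum_distrib_left algebra_simps)
  also have "(\<Sum>j<m. inner (C j (X w x)) (Y j)) = inner (X w x) (\<Sum>j<m. cadjoint (C j) (Y j))"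
    unfolding inner_sum_right
    by (intro sum.cong refl) (simp add: C_def cadjoint_inner[OF edge_contraction_clinear[OF E]])
  also have "(\<Sum>j<m. cadjoint (C j) (Y j)) = X w x"
    unfolding C_def Y_def by (rule range_martingaleD(4)[OF X w, symmetric])
  also have "(\<Sum>j<m. (norm (C j (X w x)))\<^sup>2) = (norm (X w x))\<^sup>2"
    unfolding C_def by (rule sum_edge_contraction_norm[OF E range_martingaleD(3)[OF X w]])
  finally show ?thesis
    by (simp add: power2_norm_eq_inner Y_def C_def)
qed

lemma words_len_words: "w \<in> words_len m n \<Longrightarrow> w \<in> words m"
  by (simp add: words_len_def)

lemma square_op_positive:
  assumes E: "povm m E" and X: "bounded_sa_range_martingale m E X"
  shows "positive_op (square_op m E X n)"
proof -
  have "positive_op (\<lambda>h. E_root m E w (X w (X w (E_root m E w h))))" if "w \<in> words_len m n" for w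
  proof -
    note Xw = range_martingaleD[OF X words_len_words[OF that]]
    have "positive_op (\<lambda>x. X w (X w x))"
      by (rule positive_op_conjugate[OF Xw(1,2) positive_op_ident])
    then show ?thesis
      by (rule positive_op_conjugate[OF positive_opD(1,2)[OF E_root_positive[OF E]]])
  qed
  from positive_op_sum[OF this] show ?thesis
    unfolding square_op_eq[OF E, abs_def] .
qed

lemma square_op_inner:
  assumes E: "povm m E" and X: "bounded_sa_range_martingale m E X"
  shows "inner (square_op m E X n h) h = (\<Sum>w\<in>words_len m n. (norm (X w (E_root m E w h)))\<^sup>2)"
  unfolding square_op_eq[OF E] inner_sum_left
proof (rule sum.cong[OF refl])
  fix w assume "w \<in> words_len m n"
  then have "w \<in> words m" by (rule words_len_words)
  then show "inner (E_root m E w (X w (X w (E_root m E w h)))) h = (norm (X w (E_root m E w h)))\<^sup>2"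
    by (simp only: positive_opD(2)[OF E_root_positive[OF E]] range_martingaleD(2)[OF X]
        power2_norm_eq_inner)
qed

lemma square_op_le_Suc:
  assumes E: "povm m E" and X: "bounded_sa_range_martingale m E X"
  shows "inner (square_op m E X n h) h \<le> inner (square_op m E X (Suc n) h) h"
  unfolding square_op_inner[OF E X] sum_words_len_Suc
proof (rule sum_mono)
  fix w assume "w \<in> words_len m n"
  then have "w \<in> words m" by (rule words_len_words)
  from norm_martingale_le[OF E X this, of "E_root m E w h"]
  show "(norm (X w (E_root m E w h)))\<^sup>2 \<le>
      (\<Sum>j<m. (norm (X (w @ [j]) (E_root m E (w @ [j]) h)))\<^sup>2)"
    by (simp add: edge_contraction(2)[OF E])
qed

lemma square_op_le_bound:
  assumes E: "povm m E" and X: "bounded_sa_range_martingale m E X"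
  shows "inner (square_op m E X n h) h \<le> (SUP w\<in>words m. onorm (X w))\<^sup>2 * (norm h)\<^sup>2"
proof -
  let ?M = "SUP w\<in>words m. onorm (X w)"
  have "inner (square_op m E X n h) h \<le> (\<Sum>w\<in>words_len m n. ?M\<^sup>2 * (norm (E_root m E w h))\<^sup>2)"
    unfolding square_op_inner[OF E X]
  proof (rule sum_mono)
    fix w assume "w \<in> words_len m n"
    then have "w \<in> words m" by (rule words_len_words)
    from power_mono[OF range_martingaleD(5)[OF X this] norm_ge_zero, of "E_root m E w h" 2]
    show "(norm (X w (E_root m E w h)))\<^sup>2 \<le> ?M\<^sup>2 * (norm (E_root m E w h))\<^sup>2"
      by (simp only: power_mult_distrib)
  qed
  also have "\<dots> = ?M\<^sup>2 * (norm h)\<^sup>2"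
    by (simp only: sum_E_root_norm[OF E] flip: sum_distrib_left)
  finally show ?thesis .
qed

theorem theorem7p3:
  fixes m :: nat
    and E :: "(nat \<Rightarrow> nat) set \<Rightarrow> 'a::complex_hilbert \<Rightarrow> 'a"
    and X :: "nat list \<Rightarrow> 'a \<Rightarrow> 'a"
  assumes "m \<ge> 2"
    and "povm m E"
    and "bounded_sa_range_martingale m E X"
  shows "(\<forall>n h. square_op m E X (Suc n) h - square_op m E X n h =
            (\<Sum>w\<in>words_len m n. E_root m E w (local_variance m E X w (E_root m E w h)))) \<and>
         (\<forall>n. positive_op (square_op m E X n)) \<and>
         monotone (\<le>) op_le (square_op m E X) \<and>
         (\<forall>M::real. M = (SUP w\<in>words m. onorm (X w)) \<longrightarrow>
            (\<forall>n. op_le (\<lambda>_. 0) (square_op m E X n) \<and>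
                 op_le (square_op m E X n) (\<lambda>h. M\<^sup>2 *\<^sub>R h))) \<and>
         (\<exists>Q. bounded_clinear Q \<and> (\<forall>h. (\<lambda>n. square_op m E X n h) \<longlonglongrightarrow> Q h))"
proof -
  note E = assms(2) and X = assms(3)
  note pos = square_op_positive[OF E X]
  define M where "M = (SUP w\<in>words m. onorm (X w))"
  have le: "op_le (square_op m E X n) (square_op m E X k)" if "n \<le> k" for n k
  proof (rule op_leI[OF pos pos])
    show "inner (square_op m E X n h) h \<le> inner (square_op m E X k h) h" for h
      using that
      by (rule lift_Suc_mono_le[of "\<lambda>n. inner (square_op m E X n h) h", rotated])
        (rule square_op_le_Suc[OF E X])
  qed
  have bound: "inner (square_op m E X n h) h \<le> M\<^sup>2 * (norm h)\<^sup>2" for n h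
    unfolding M_def by (rule square_op_le_bound[OF E X])
  have le_M: "op_le (square_op m E X n) (\<lambda>h. M\<^sup>2 *\<^sub>R h)" for n
    by (rule op_leI[OF pos positive_op_scaleR[OF positive_op_ident]])
      (use bound in \<open>simp_all add: power2_norm_eq_inner\<close>)
  have ge_0: "op_le (\<lambda>_. 0) (square_op m E X n)" for n
    by (rule op_leI[OF positive_op_zero pos]) (simp add: positive_opD(3)[OF pos])
  \<comment> \<open>\<open>M\<close> may vanish, while the limit theorem needs a positive bound.\<close>
  have bound': "inner (square_op m E X n h) h \<le> (M\<^sup>2 + 1) * (norm h)\<^sup>2" for n h
    using bound[of n h] by (simp add: distrib_right add_increasing2)
  obtain Q where Q: "positive_op Q" "\<And>h. (\<lambda>n. square_op m E X n h) \<longlonglongrightarrow> Q h"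
  proof (rule increasing_positive_op_limit[of "square_op m E X" "M\<^sup>2 + 1"])
    show "op_le (square_op m E X n) (square_op m E X (Suc n))" for n
      by (rule le) simp
    show "M\<^sup>2 + 1 > 0"
      by (simp add: add_nonneg_pos)
    fix Q
    assume "positive_op Q" "\<And>h. (\<lambda>n. square_op m E X n h) \<longlonglongrightarrow> Q h"
    then show thesis by (rule that)
  qed (rule pos bound')+
  show ?thesis
  proof (intro conjI allI impI)
    show "square_op m E X (Suc n) h - square_op m E X n h =
        (\<Sum>w\<in>words_len m n. E_root m E w (local_variance m E X w (E_root m E w h)))" for n h
      by (rule square_op_Suc_diff[OF E])
    show "positive_op (square_op m E X n)" for n
      by (rule pos)
    show "monotone (\<le>) op_le (square_op m E X)"
      by (rule monotoneI) (rule le)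
    show "op_le (\<lambda>_. 0) (square_op m E X n)" for n
      by (rule ge_0)
    show "op_le (square_op m E X n) (\<lambda>h. M'\<^sup>2 *\<^sub>R h)" if "M' = (SUP w\<in>words m. onorm (X w))" for M' n
      unfolding that M_def[symmetric] by (rule le_M)
    show "\<exists>Q. bounded_clinear Q \<and> (\<forall>h. (\<lambda>n. square_op m E X n h) \<longlonglongrightarrow> Q h)"
      using Q positive_opD(1) by blast
  qed
qed

end
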